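(* Let $K$ and $K'$ be compact convex bodies in $\mathbb{R}^2$ whose boundaries are real-analytic, strictly convex, positively curved and non-conic (i.e. not contained in a conic). Then $K\equiv_{\mathcal{L}_{\mathrm{B}}}K'$ if and only if $K$ and $K'$ are projectively equivalent.
   Context: $\mathcal{L}_{\mathrm{B}}$ is the first-order language with a single ternary relation symbol $B$. A convex set $K\subseteq\mathbb{R}^2$ is an $\mathcal{L}_{\mathrm{B}}$-structure with universe $K$, where $B(a,x,b)$ holds iff $x\in[a,b]$ (the closed segment). $\equiv_{\mathcal{L}_{\mathrm{B}}}$ denotes elementary equivalence (same first-order $\mathcal{L}_{\mathrm{B}}$-sentences). A convex body is a compact convex set with nonempty interior. Convex sets $K,K'\subseteq\mathbb{R}^2\subseteq\mathbb{RP}^2$ are projectively equivalent if there is $T\in\mathrm{PGL}_3(\mathbb{R})$ whose singular line (the preimage of the line at infinity) is disjoint from $K$ and with $T(K)=K'$. "Positively curved" means the curvature of the boundary curve is everywhere strictly positive. *)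

theory Defs
  imports "HOL-Analysis.Analysis"
begin

section \<open>First-order logic with one ternary relation symbol\<close>

text \<open>Variables are named by natural numbers. The omitted connectives and the existential
  quantifier are definable from the given ones.\<close>

datatype fm =
    Eq nat nat
  | Btw nat nat nat
  | Neg fm
  | Conj fm fm
  | All nat fm

fun free_vars :: "fm \<Rightarrow> nat set" where
  "free_vars (Eq i j) = {i, j}"
| "free_vars (Btw i j k) = {i, j, k}"
| "free_vars (Neg \<phi>) = free_vars \<phi>"
| "free_vars (Conj \<phi> \<psi>) = free_vars \<phi> \<union> free_vars \<psi>"
| "free_vars (All i \<phi>) = free_vars \<phi> - {i}"

definition sentence :: "fm \<Rightarrow> bool" where
  "sentence \<phi> \<longleftrightarrow> free_vars \<phi> = {}"

fun sat :: "'a set \<Rightarrow> ('a \<Rightarrow> 'a \<Rightarrow> 'a \<Rightarrow> bool) \<Rightarrow> (nat \<Rightarrow> 'a) \<Rightarrow> fm \<Rightarrow> bool" where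
  "sat M R e (Eq i j) \<longleftrightarrow> e i = e j"
| "sat M R e (Btw i j k) \<longleftrightarrow> R (e i) (e j) (e k)"
| "sat M R e (Neg \<phi>) \<longleftrightarrow> \<not> sat M R e \<phi>"
| "sat M R e (Conj \<phi> \<psi>) \<longleftrightarrow> sat M R e \<phi> \<and> sat M R e \<psi>"
| "sat M R e (All i \<phi>) \<longleftrightarrow> (\<forall>a\<in>M. sat M R (e(i := a)) \<phi>)"

definition models :: "'a set \<Rightarrow> ('a \<Rightarrow> 'a \<Rightarrow> 'a \<Rightarrow> bool) \<Rightarrow> fm \<Rightarrow> bool" where
  "models M R \<phi> \<longleftrightarrow> (\<forall>e. range e \<subseteq> M \<longrightarrow> sat M R e \<phi>)"

definition between :: "real^2 \<Rightarrow> real^2 \<Rightarrow> real^2 \<Rightarrow> bool" where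
  "between a x b \<longleftrightarrow> x \<in> closed_segment a b"

definition elem_equiv :: "(real^2) set \<Rightarrow> (real^2) set \<Rightarrow> bool" where
  "elem_equiv K K' \<longleftrightarrow>
     (\<forall>\<phi>. sentence \<phi> \<longrightarrow> (models K between \<phi> \<longleftrightarrow> models K' between \<phi>))"


section \<open>Projective equivalence\<close>

text \<open>Points of the real projective plane are the lines through the origin of 3-space; the affine
  plane is embedded by sending (x,y) to [x:y:1]. An element of PGL(3) is represented by an
  invertible matrix, acting on lines by direct image.\<close>

definition proj_plane :: "(real^3) set set" where
  "proj_plane = {L. subspace L \<and> dim L = 1}"

definition embed :: "real^2 \<Rightarrow> (real^3) set" where
  "embed p = span {vector [p $ 1, p $ 2, 1]}"

definition line_at_infinity :: "(real^3) set set" where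
  "line_at_infinity = {L \<in> proj_plane. \<forall>v\<in>L. v $ 3 = 0}"

definition proj_act :: "real^3^3 \<Rightarrow> (real^3) set \<Rightarrow> (real^3) set" where
  "proj_act A L = (\<lambda>v. A *v v) ` L"

definition singular_line :: "real^3^3 \<Rightarrow> (real^3) set set" where
  "singular_line A = {L \<in> proj_plane. proj_act A L \<in> line_at_infinity}"

definition proj_equivalent :: "(real^2) set \<Rightarrow> (real^2) set \<Rightarrow> bool" where
  "proj_equivalent K K' \<longleftrightarrow>
     (\<exists>A :: real^3^3. invertible A \<and> singular_line A \<inter> embed ` K = {} \<and>
        proj_act A ` embed ` K = embed ` K')"


section \<open>Convex bodies and their boundaries\<close>

definition convex_body :: "(real^2) set \<Rightarrow> bool" where
  "convex_body K \<longleftrightarrow> compact K \<and> convex K \<and> interior K \<noteq> {}"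

definition strictly_convex :: "(real^2) set \<Rightarrow> bool" where
  "strictly_convex K \<longleftrightarrow>
     (\<forall>x\<in>K. \<forall>y\<in>K. x \<noteq> y \<longrightarrow> open_segment x y \<subseteq> interior K)"

definition real_analytic_on :: "(real \<Rightarrow> 'a::real_normed_vector) \<Rightarrow> real set \<Rightarrow> bool" where
  "real_analytic_on f I \<longleftrightarrow>
     (\<forall>t\<in>I. \<exists>r>0. \<exists>c :: nat \<Rightarrow> 'a. \<forall>s. \<bar>s - t\<bar> < r \<longrightarrow>
        (\<lambda>n. (s - t) ^ n *\<^sub>R c n) sums f s)"

text \<open>A regular real-analytic parametrization, by an open set of reals, of the part of \<open>S\<close> inside
  an open set \<open>U\<close>. Requiring a homeomorphism onto \<open>S \<inter> U\<close> makes \<open>analytic_curve\<close> below say that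
  \<open>S\<close> is an embedded one-dimensional real-analytic submanifold of the plane.\<close>

definition analytic_param ::
    "(real^2) set \<Rightarrow> (real \<Rightarrow> real^2) \<Rightarrow> real set \<Rightarrow> (real^2) set \<Rightarrow> bool" where
  "analytic_param S \<gamma> I U \<longleftrightarrow>
     open I \<and> open U \<and> real_analytic_on \<gamma> I \<and>
     (\<forall>t\<in>I. vector_derivative \<gamma> (at t) \<noteq> 0) \<and>
     (\<exists>g. homeomorphism I (S \<inter> U) \<gamma> g)"

definition analytic_curve :: "(real^2) set \<Rightarrow> bool" where
  "analytic_curve S \<longleftrightarrow> (\<forall>p\<in>S. \<exists>\<gamma> I U. p \<in> U \<and> analytic_param S \<gamma> I U)"

definition curvature :: "(real \<Rightarrow> real^2) \<Rightarrow> real \<Rightarrow> real" where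
  "curvature \<gamma> t =
     (let v = vector_derivative \<gamma> (at t);
          a = vector_derivative (\<lambda>s. vector_derivative \<gamma> (at s)) (at t)
      in \<bar>v $ 1 * a $ 2 - v $ 2 * a $ 1\<bar> / norm v ^ 3)"

text \<open>The unsigned curvature does not depend on the parametrization, so an existential quantifier
  over parametrizations is as good as a universal one, and it cannot hold vacuously.\<close>

definition positively_curved :: "(real^2) set \<Rightarrow> bool" where
  "positively_curved S \<longleftrightarrow>
     (\<forall>p\<in>S. \<exists>\<gamma> I U t. analytic_param S \<gamma> I U \<and> t \<in> I \<and> \<gamma> t = p \<and> curvature \<gamma> t > 0)"

definition conic :: "(real^2) set \<Rightarrow> bool" where
  "conic C \<longleftrightarrow> (\<exists>a b c d e f :: real. (a, b, c) \<noteq> (0, 0, 0) \<and>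
     C = {p. a * (p $ 1)\<^sup>2 + b * (p $ 1) * (p $ 2) + c * (p $ 2)\<^sup>2 + d * (p $ 1) + e * (p $ 2) + f = 0})"

definition non_conic :: "(real^2) set \<Rightarrow> bool" where
  "non_conic S \<longleftrightarrow> (\<nexists>C. conic C \<and> S \<subseteq> C)"

end

theory Submission
  imports Defs
begin

text \<open>Suppose that \<open>K\<close> and \<open>K'\<close> are elementarily equivalent. Every finite subset \<open>F\<close> of \<open>K\<close> then has a copy
  in \<open>K'\<close> with the same betweenness relation, in which boundary points (extreme points, a definable
  notion) correspond to boundary points. Fix a triangle in \<open>K\<close> and its centroid, and let \<open>T F\<close> be the
  projective map that agrees with the copy \<open>g F\<close> on these four points. As \<open>F\<close> grows, \<open>g F\<close> agrees with \<open>T F\<close>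
  on the rational net of this frame, hence asymptotically, in the coordinates of \<open>T F\<close>, everywhere.
  Normalize the matrices \<open>T F\<close> and take a cluster point \<open>L\<close>. If \<open>L\<close> is invertible, it maps \<open>K\<close> onto \<open>K'\<close>.
  If not, then up to finitely many exceptions the whole boundary of \<open>K\<close> is contracted to one boundary
  point of \<open>K'\<close>. There the boundary of \<open>K'\<close> is positively curved, so in the limit six points on it satisfy
  the projectively invariant condition of lying on a conic. Hence the boundary of \<open>K\<close> is contained in a conic,
  which is excluded.\<close>

section \<open>Transfer of finite configurations\<close>

text \<open>A single \<open>F\<close> makes only finitely many incidences of \<open>g F\<close>
  reliable, and only for points of \<open>K\<close>. Hence the von Staudt construction of the
  rational numbers is carried out inside the frame triangle: one vertex is the origin, the opposite
  edge is the line at infinity, and only positive coordinates, sums and quotients occur. Betweenness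
  supplies the order: an irrational point of an edge is confined between rational ones, and every
  other point of \<open>K\<close> is an intersection of lines through points already located. In the
  singular case the limit matrix forgets the shape of \<open>K\<close>; what survives is a quotient
  of determinants that is exactly invariant under each \<open>T F\<close>. On a positively curved
  arc the determinant of three points is asymptotically a nonzero constant times the Vandermonde
  determinant of their parameters. In the chosen quotient the Vandermonde factors cancel exactly,
  whatever the relative speed at which the six points come together.\<close>

lemma models_All: "models M R (All i \<phi>) \<longleftrightarrow> models M R \<phi>"
proof
  assume L: "models M R (All i \<phi>)"
  show "models M R \<phi>" unfolding models_def
  proof (intro allI impI)
    fix e :: "nat \<Rightarrow> 'a" assume e: "range e \<subseteq> M"
    then have "\<forall>a\<in>M. sat M R (e(i := a)) \<phi>" using L by (simp add: models_def)
    from this[rule_format, of "e i"] e show "sat M R e \<phi>" by (simp add: range_subsetD)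
  qed
next
  assume L: "models M R \<phi>"
  show "models M R (All i \<phi>)" unfolding models_def sat.simps
  proof (intro allI impI ballI)
    fix e :: "nat \<Rightarrow> 'a" and a assume "range e \<subseteq> M" "a \<in> M"
    then have "range (e(i := a)) \<subseteq> M" by (auto simp: fun_upd_def)
    then show "sat M R (e(i := a)) \<phi>" using L by (simp add: models_def)
  qed
qed

lemma finite_free_vars: "finite (free_vars \<phi>)"
  by (induction \<phi>) auto

lemma models_fold_All: "models M R (fold All is \<phi>) \<longleftrightarrow> models M R \<phi>"
  by (induction "is" arbitrary: \<phi>) (simp_all add: models_All)

lemma free_vars_fold_All: "free_vars (fold All is \<phi>) = free_vars \<phi> - set is"
  by (induction "is" arbitrary: \<phi>) auto

text \<open>An open formula is valid exactly when its universal closure is, and the closure is a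
  sentence. Later arguments can thus describe configurations by free variables.\<close>

lemma elem_equiv_models:
  assumes "elem_equiv K K'"
  shows "models K between \<phi> \<longleftrightarrow> models K' between \<phi>"
proof -
  obtain "is" where "set is = free_vars \<phi>"
    using finite_list[OF finite_free_vars] by blast
  then have "sentence (fold All is \<phi>)" by (simp add: sentence_def free_vars_fold_All)
  then show ?thesis using assms unfolding elem_equiv_def by (metis models_fold_All)
qed

text \<open>The sign is chosen to make the result true under \<open>e\<close>; a conjunction of
  literals then records the type of \<open>e\<close> with respect to finitely many formulas.\<close>

definition literal :: "'a set \<Rightarrow> ('a \<Rightarrow> 'a \<Rightarrow> 'a \<Rightarrow> bool) \<Rightarrow> (nat \<Rightarrow> 'a) \<Rightarrow> fm \<Rightarrow> fm" where
  "literal M R e \<phi> = (if sat M R e \<phi> then \<phi> else Neg \<phi>)"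

lemma sat_literal: "sat M' R' e' (literal M R e \<phi>) \<longleftrightarrow> (sat M' R' e' \<phi> \<longleftrightarrow> sat M R e \<phi>)"
  by (simp add: literal_def)

lemma sat_foldr_Conj:
  "sat M R e (foldr (\<lambda>\<phi>. Conj (f \<phi>)) \<phi>s (Eq 0 0)) \<longleftrightarrow> (\<forall>\<phi>\<in>set \<phi>s. sat M R e (f \<phi>))"
  by (induction \<phi>s) auto

text \<open>That some assignment satisfies the conjunction \<open>\<psi>\<close> of literals is the
  failure of \<open>models\<close> for \<open>Neg \<psi>\<close>, and this failure transfers.
  \<open>Eq 0 0\<close> serves as the empty conjunction.\<close>

lemma elem_equiv_transfer_finite:
  assumes "elem_equiv K K'" "finite \<Phi>" "range e \<subseteq> K"
  obtains e' where "range e' \<subseteq> K'"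
    "\<And>\<phi>. \<phi> \<in> \<Phi> \<Longrightarrow> sat K' between e' \<phi> \<longleftrightarrow> sat K between e \<phi>"
proof -
  obtain \<phi>s where \<phi>s: "set \<phi>s = \<Phi>" using finite_list assms(2) by blast
  define \<psi> where "\<psi> = foldr (\<lambda>\<phi>. Conj (literal K between e \<phi>)) \<phi>s (Eq 0 0)"
  have "sat K between e \<psi>" by (simp only: \<psi>_def sat_foldr_Conj sat_literal) simp
  then have "\<not> models K between (Neg \<psi>)" using assms(3) by (auto simp: models_def)
  then have "\<not> models K' between (Neg \<psi>)" using elem_equiv_models[OF assms(1)] by blast
  then obtain e' where e': "range e' \<subseteq> K'" "sat K' between e' \<psi>" by (auto simp: models_def)
  have "\<forall>\<phi>\<in>\<Phi>. sat K' between e' \<phi> \<longleftrightarrow> sat K between e \<phi>"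
    using e'(2) by (simp only: \<psi>_def sat_foldr_Conj sat_literal \<phi>s)
  then show ?thesis using that[OF e'(1)] by blast
qed

text \<open>The bound variables are numbered after \<open>i\<close>, so they differ from it and from
  each other.\<close>

definition extreme_fm :: "nat \<Rightarrow> fm" where
  "extreme_fm i = All (Suc i) (All (Suc (Suc i)) (Neg (Conj (Btw (Suc i) i (Suc (Suc i)))
     (Conj (Neg (Eq i (Suc i))) (Neg (Eq i (Suc (Suc i))))))))"

text \<open>A boundary point strictly inside a segment of \<open>K\<close> would be interior by
  strict convexity; an interior point is the midpoint of a short segment in
  \<open>K\<close>.\<close>

lemma frontier_iff_extreme:
  assumes "convex_body K" "strictly_convex K" "x \<in> K"
  shows "x \<in> frontier K \<longleftrightarrow> (\<forall>a\<in>K. \<forall>b\<in>K. \<not> (between a x b \<and> x \<noteq> a \<and> x \<noteq> b))"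
proof -
  have clo: "closed K" using assms(1) by (simp add: convex_body_def compact_imp_closed)
  then have fr: "x \<in> frontier K \<longleftrightarrow> x \<notin> interior K"
    using assms(3) by (simp add: frontier_def)
  show ?thesis
  proof
    assume "x \<in> frontier K"
    then have nx: "x \<notin> interior K" using fr by simp
    show "\<forall>a\<in>K. \<forall>b\<in>K. \<not> (between a x b \<and> x \<noteq> a \<and> x \<noteq> b)"
    proof (intro ballI notI)
      fix a b assume "a \<in> K" "b \<in> K" and h: "between a x b \<and> x \<noteq> a \<and> x \<noteq> b"
      then have "x \<in> open_segment a b" by (simp add: between_def open_segment_def)
      moreover then have "a \<noteq> b" by auto
      ultimately show False using nx assms(2) \<open>a \<in> K\<close> \<open>b \<in> K\<close>
        unfolding strictly_convex_def by blast
    qed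
  next
    assume E: "\<forall>a\<in>K. \<forall>b\<in>K. \<not> (between a x b \<and> x \<noteq> a \<and> x \<noteq> b)"
    have "x \<notin> interior K"
    proof
      assume "x \<in> interior K"
      then obtain d where d: "d > 0" "ball x d \<subseteq> K" by (meson mem_interior)
      define w :: "real^2" where "w = (d/2) *\<^sub>R axis 1 1"
      have w: "norm w = d/2" using d by (simp add: w_def norm_axis_1)
      then have "x + w \<in> K" "x - w \<in> K" using d by (auto simp: subset_iff dist_norm)
      moreover have "between (x - w) x (x + w)"
      proof -
        have "midpoint (x - w) (x + w) = x" by (simp add: midpoint_def scaleR_2[symmetric])
        then show ?thesis unfolding between_def by (metis midpoint_in_closed_segment)
      qed
      moreover have "w \<noteq> 0" using w d by auto
      ultimately show False using E by force
    qed
    then show "x \<in> frontier K" using fr by simp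
  qed
qed

lemma sat_extreme_fm:
  assumes "convex_body K" "strictly_convex K" "range e \<subseteq> K"
  shows "sat K between e (extreme_fm i) \<longleftrightarrow> e i \<in> frontier K"
proof -
  have "e i \<in> K" using assms(3) by auto
  then show ?thesis by (auto simp: frontier_iff_extreme[OF assms(1,2)] extreme_fm_def)
qed

text \<open>The points of \<open>F\<close> are named by variables, and all betweenness atoms and all
  \<open>extreme_fm\<close> on these variables are transferred. Injectivity on \<open>F\<close> is
  implicit, since \<open>between a x a\<close> means \<open>x = a\<close>.\<close>

lemma elem_equiv_finite_embedding:
  assumes "elem_equiv K K'" and K: "convex_body K" "strictly_convex K"
    and K': "convex_body K'" "strictly_convex K'"
    and F: "finite F" "F \<subseteq> K"
  obtains g where "\<And>x. g x \<in> K'"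
    "\<And>a x b. \<lbrakk>a \<in> F; x \<in> F; b \<in> F\<rbrakk> \<Longrightarrow> between (g a) (g x) (g b) \<longleftrightarrow> between a x b"
    "\<And>x. x \<in> F \<Longrightarrow> g x \<in> frontier K' \<longleftrightarrow> x \<in> frontier K"
proof -
  obtain z where z: "z \<in> K" using K(1) interior_subset unfolding convex_body_def by blast
  obtain n and h :: "nat \<Rightarrow> real^2" where h: "F = h ` {i. i < n}" "inj_on h {i. i < n}"
    using finite_imp_nat_seg_image_inj_on[OF F(1)] by blast
  \<comment> \<open>Variables that name no point of \<open>F\<close> get the default value
    \<open>z\<close>, so that \<open>e\<close> is an assignment into \<open>K\<close>.\<close>
  define e where "e i = (if i < n then h i else z)" for i
  have e: "range e \<subseteq> K" using h F(2) z by (auto simp: e_def)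
  define \<Phi> where "\<Phi> = (\<lambda>(i,j,k). Btw i j k) ` ({..<n} \<times> {..<n} \<times> {..<n}) \<union> extreme_fm ` {..<n}"
  have "finite \<Phi>" by (simp add: \<Phi>_def)
  then obtain e' where e': "range e' \<subseteq> K'"
      "\<And>\<phi>. \<phi> \<in> \<Phi> \<Longrightarrow> sat K' between e' \<phi> \<longleftrightarrow> sat K between e \<phi>"
    using elem_equiv_transfer_finite[OF assms(1) _ e] by blast
  define ix where "ix = the_inv_into {i. i < n} h"
  have ix: "ix x < n" "e (ix x) = x" if "x \<in> F" for x
  proof -
    show 1: "ix x < n" using the_inv_into_into[OF h(2), of x "{i. i < n}"] that h(1) by (simp add: ix_def)
    show "e (ix x) = x" using f_the_inv_into_f[OF h(2), of x] that h(1) 1 by (simp add: ix_def e_def)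
  qed
  show ?thesis
  proof (rule that[of "\<lambda>x. e' (ix x)"])
    show "e' (ix x) \<in> K'" for x using e'(1) by auto
    show "between (e' (ix a)) (e' (ix x)) (e' (ix b)) \<longleftrightarrow> between a x b"
      if "a \<in> F" "x \<in> F" "b \<in> F" for a x b
    proof -
      have "Btw (ix a) (ix x) (ix b) \<in> \<Phi>" unfolding \<Phi>_def using ix that by (force simp: image_iff)
      from e'(2)[OF this] show ?thesis using ix that by simp
    qed
    show "e' (ix x) \<in> frontier K' \<longleftrightarrow> x \<in> frontier K" if "x \<in> F" for x
    proof -
      have "extreme_fm (ix x) \<in> \<Phi>" unfolding \<Phi>_def using ix that by auto
      from e'(2)[OF this] show ?thesis
        using sat_extreme_fm[OF K' e'(1)] sat_extreme_fm[OF K e] ix that by simp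
    qed
  qed
qed

section \<open>Invariance of truth under isomorphisms of structures\<close>

lemma sat_isomorphism:
  assumes "bij_betw f M M'" "\<And>a b c. \<lbrakk>a \<in> M; b \<in> M; c \<in> M\<rbrakk> \<Longrightarrow> R' (f a) (f b) (f c) \<longleftrightarrow> R a b c"
    "range e \<subseteq> M"
  shows "sat M' R' (f \<circ> e) \<phi> \<longleftrightarrow> sat M R e \<phi>"
  using assms(3)
proof (induction \<phi> arbitrary: e)
  case (Eq i j)
  then have "e i \<in> M" "e j \<in> M" by auto
  then show ?case using assms(1) by (auto simp: bij_betw_def inj_on_def)
next
  case (Btw i j k)
  then have "e i \<in> M" "e j \<in> M" "e k \<in> M" by auto
  then show ?case using assms(2) by simp
next
  case (All i \<phi>)
  have upd: "(f \<circ> e)(i := f a) = f \<circ> e(i := a)" for a by (rule fun_upd_comp[symmetric])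
  have rng: "range (e(i := a)) \<subseteq> M" if "a \<in> M" for a using All.prems that by (auto simp: fun_upd_def)
  have "M' = f ` M" using assms(1) by (simp add: bij_betw_def)
  then show ?case using All.IH[OF rng] by (simp add: upd del: fun_upd_apply comp_apply)
qed auto

lemma models_isomorphism:
  assumes "bij_betw f M M'" "\<And>a b c. \<lbrakk>a \<in> M; b \<in> M; c \<in> M\<rbrakk> \<Longrightarrow> R' (f a) (f b) (f c) \<longleftrightarrow> R a b c"
  shows "models M' R' \<phi> \<longleftrightarrow> models M R \<phi>"
proof
  assume L: "models M' R' \<phi>"
  show "models M R \<phi>" unfolding models_def
  proof (intro allI impI)
    fix e :: "nat \<Rightarrow> 'a" assume e: "range e \<subseteq> M"
    then have "range (f \<circ> e) \<subseteq> M'" using assms(1) by (auto simp: bij_betw_def)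
    then have "sat M' R' (f \<circ> e) \<phi>" using L by (simp add: models_def)
    then show "sat M R e \<phi>" using sat_isomorphism[where R = R and R' = R', OF assms e] by blast
  qed
next
  assume L: "models M R \<phi>"
  show "models M' R' \<phi>" unfolding models_def
  proof (intro allI impI)
    fix e' :: "nat \<Rightarrow> 'b" assume e': "range e' \<subseteq> M'"
    define e where "e = inv_into M f \<circ> e'"
    have e: "range e \<subseteq> M" and fe: "f \<circ> e = e'"
      using e' assms(1) by (auto simp: e_def bij_betw_def inv_into_into f_inv_into_f subset_iff)
    show "sat M' R' e' \<phi>" using L sat_isomorphism[where R = R and R' = R', OF assms e] e by (simp add: models_def fe)
  qed
qed

section \<open>Homogeneous coordinates\<close>

definition hat :: "real^2 \<Rightarrow> real^3" where "hat p = vector [p $ 1, p $ 2, 1]"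

text \<open>The 3x3 determinant, written as a triple product because \<open>cross3 a b\<close> is
  the coordinate vector of the line through \<open>a\<close> and \<open>b\<close>.\<close>

definition D3 :: "real^3 \<Rightarrow> real^3 \<Rightarrow> real^3 \<Rightarrow> real" where "D3 a b c = cross3 a b \<bullet> c"

lemma hat_nth [simp]: "hat p $ 1 = p $ 1" "hat p $ 2 = p $ 2" "hat p $ 3 = 1"
  by (simp_all add: hat_def)

lemma hat_neq_0 [simp]: "hat p \<noteq> 0"
  by (metis hat_nth(3) zero_index zero_neq_one)

lemma embed_hat: "embed p = span {hat p}"
  by (simp add: embed_def hat_def)

lemma hat_eq_scale_iff: "hat p = k *\<^sub>R hat q \<longleftrightarrow> k = 1 \<and> p = q"
  by (auto simp: vec_eq_iff forall_3 forall_2)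

lemma hat_inject [simp]: "hat p = hat q \<longleftrightarrow> p = q"
  by (auto simp: vec_eq_iff forall_3 forall_2)

lemma tendsto_hat [tendsto_intros]: "(f \<longlongrightarrow> p) F \<Longrightarrow> ((\<lambda>x. hat (f x)) \<longlongrightarrow> hat p) F"
  unfolding hat_def vector_def by (intro vec_tendstoI) (auto simp: forall_3 intro!: tendsto_intros)

lemma between_iff_hat:
  "between a x b \<longleftrightarrow> (\<exists>t. 0 \<le> t \<and> t \<le> 1 \<and> hat x = (1 - t) *\<^sub>R hat a + t *\<^sub>R hat b)"
  unfolding between_def in_segment by (auto simp: vec_eq_iff forall_3 forall_2)

lemma between_self_iff: "between a x a \<longleftrightarrow> x = a"
  by (simp add: between_def)

lemma D3_expand: "D3 a b c = (a$2 * b$3 - a$3 * b$2) * c$1 + (a$3 * b$1 - a$1 * b$3) * c$2 + (a$1 * b$2 - a$2 * b$1) * c$3"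
  by (simp add: D3_def cross3_def inner_vec_def sum_3)

lemma tendsto_D3 [tendsto_intros]:
  "(f \<longlongrightarrow> a) F \<Longrightarrow> (g \<longlongrightarrow> b) F \<Longrightarrow> (h \<longlongrightarrow> c) F \<Longrightarrow> ((\<lambda>x. D3 (f x) (g x) (h x)) \<longlongrightarrow> D3 a b c) F"
  unfolding D3_expand by (intro tendsto_intros)

lemma D3_scale [simp]:
  "D3 (k *\<^sub>R a) b c = k * D3 a b c" "D3 a (k *\<^sub>R b) c = k * D3 a b c" "D3 a b (k *\<^sub>R c) = k * D3 a b c"
  by (simp_all add: D3_expand algebra_simps)

lemma D3_add:
  "D3 (a + a') b c = D3 a b c + D3 a' b c" "D3 a (b + b') c = D3 a b c + D3 a b' c"
  "D3 a b (c + c') = D3 a b c + D3 a b c'"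
  by (simp_all add: D3_expand algebra_simps)

lemma D3_same [simp]: "D3 a a c = 0" "D3 a b a = 0" "D3 a b b = 0"
  by (simp_all add: D3_expand algebra_simps)

lemma D3_matrix: "D3 (A *v a) (A *v b) (A *v c) = det A * D3 a b c"
  by (simp add: D3_expand matrix_vector_mult_def sum_3 det_3 algebra_simps)

text \<open>Collinearity is expressible by betweenness, so it is preserved by any map that preserves
  betweenness in both directions.\<close>

lemma D3_hat_eq_0_iff:
  "D3 (hat a) (hat b) (hat c) = 0 \<longleftrightarrow> between a b c \<or> between b c a \<or> between c a b"
proof
  assume D: "D3 (hat a) (hat b) (hat c) = 0"
  show "between a b c \<or> between b c a \<or> between c a b"
  proof (cases "a = b")
    case True then show ?thesis by (simp add: between_def)
  next
    case False
    have eq: "(b$1 - a$1) * (c$2 - a$2) = (b$2 - a$2) * (c$1 - a$1)"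
      using D by (simp add: D3_expand algebra_simps)
    have "\<exists>k. c$1 = a$1 + k * (b$1 - a$1) \<and> c$2 = a$2 + k * (b$2 - a$2)"
    proof (cases "a$1 = b$1")
      case True
      then have "a$2 \<noteq> b$2" using False by (auto simp: vec_eq_iff forall_2)
      then show ?thesis using eq True by (intro exI[of _ "(c$2 - a$2) / (b$2 - a$2)"]) auto
    next
      case False
      then show ?thesis using eq by (intro exI[of _ "(c$1 - a$1) / (b$1 - a$1)"]) (auto simp: divide_simps algebra_simps)
    qed
    then obtain k where k: "hat c = (1 - k) *\<^sub>R hat a + k *\<^sub>R hat b"
      by (auto simp: vec_eq_iff forall_3 algebra_simps)
    \<comment> \<open>The position \<open>k\<close> of \<open>c\<close> on the line
      \<open>ab\<close> decides which point is in the middle; solving for that point gives its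
      weight \<open>1 / (1 - k)\<close>, \<open>k\<close> or \<open>1 / k\<close>.\<close>
    consider "k < 0" | "0 \<le> k" "k \<le> 1" | "1 < k" by linarith
    then show ?thesis
    proof cases
      case 1
      have r: "1 / (1 - k) * (1 - k) = 1" "1 - 1 / (1 - k) + 1 / (1 - k) * k = 0"
        using 1 by (simp_all add: divide_simps)
      have "(1 - 1 / (1 - k)) *\<^sub>R hat b + (1 / (1 - k)) *\<^sub>R hat c =
          (1 / (1 - k) * (1 - k)) *\<^sub>R hat a + (1 - 1 / (1 - k) + 1 / (1 - k) * k) *\<^sub>R hat b"
        unfolding k scaleR_add_right scaleR_add_left scaleR_scaleR by simp
      then have "hat a = (1 - 1 / (1 - k)) *\<^sub>R hat b + (1 / (1 - k)) *\<^sub>R hat c"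
        unfolding r by simp
      then have "between b a c" unfolding between_iff_hat using 1
        by (intro exI[of _ "1/(1-k)"]) (auto simp: field_simps)
      then show ?thesis by (simp add: between_def closed_segment_commute)
    next
      case 2
      then have "between a c b" using k unfolding between_iff_hat by blast
      then show ?thesis by (simp add: between_def closed_segment_commute)
    next
      case 3
      have "hat b = (1 - 1 / k) *\<^sub>R hat a + (1 / k) *\<^sub>R hat c"
        using 3 by (simp add: k vec_eq_iff forall_3 field_simps)
      then have "between a b c" unfolding between_iff_hat using 3
        by (intro exI[of _ "1/k"]) (auto simp: field_simps)
      then show ?thesis by simp
    qed
  qed
next
  have *: "D3 (hat a) (hat b) (hat c) = 0 \<and> D3 (hat c) (hat a) (hat b) = 0 \<and> D3 (hat b) (hat c) (hat a) = 0"
    if "between a b c" for a b c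
    using that unfolding between_iff_hat by (auto simp: D3_add)
  assume "between a b c \<or> between b c a \<or> between c a b"
  then show "D3 (hat a) (hat b) (hat c) = 0" using * by blast
qed

text \<open>By the Lagrange identity \<open>cross3 w (cross3 m n)\<close> is a combination of
  \<open>m\<close> and \<open>n\<close> with coefficients \<open>w \<bullet> n\<close> and
  \<open>w \<bullet> m\<close> up to sign. Geometrically, the common point of two distinct lines is
  their cross product.\<close>

lemma cross3_parallel:
  assumes "m \<bullet> w = 0" "n \<bullet> w = 0" "cross3 m n \<noteq> 0"
  obtains k where "w = k *\<^sub>R cross3 m n"
proof -
  have "cross3 w (cross3 m n) = 0"
    using assms(1,2) by (simp add: Lagrange inner_commute)
  then have "collinear {0, cross3 m n, w}"
    by (simp add: cross_eq_0 insert_commute)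
  then show ?thesis using that assms(3) unfolding collinear_lemma by (metis scaleR_zero_left)
qed

text \<open>Of three distinct collinear points one lies strictly between the others, hence in the
  interior by strict convexity.\<close>

lemma frontier_det_neq_0:
  assumes K: "convex_body K" "strictly_convex K"
    and fr: "a \<in> frontier K" "b \<in> frontier K" "c \<in> frontier K" and ne: "a \<noteq> b" "b \<noteq> c" "a \<noteq> c"
  shows "D3 (hat a) (hat b) (hat c) \<noteq> 0"
proof
  assume D: "D3 (hat a) (hat b) (hat c) = 0"
  have sub: "frontier K \<subseteq> K" "\<And>x. x \<in> frontier K \<Longrightarrow> x \<notin> interior K"
    using K(1) by (auto simp: convex_body_def frontier_def compact_imp_closed)
  have nob: False if "between x y z" "x \<in> frontier K" "y \<in> frontier K" "z \<in> frontier K"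
    "x \<noteq> y" "y \<noteq> z" "x \<noteq> z" for x y z
  proof -
    have "y \<in> open_segment x z" using that by (auto simp: between_def open_segment_def)
    moreover have "x \<in> K" "z \<in> K" using that sub by auto
    ultimately have "y \<in> interior K" using K(2) that(7) unfolding strictly_convex_def by blast
    then show False using that(3) sub by auto
  qed
  show False using D nob[of a b c] nob[of b c a] nob[of c a b] fr ne unfolding D3_hat_eq_0_iff by auto
qed

text \<open>The line is given by the linear form with coefficients \<open>n\<close>; it may be the line at infinity.\<close>

lemma finite_frontier_line:
  assumes K: "convex_body K" "strictly_convex K" and n: "n \<noteq> 0"
  shows "finite {x \<in> frontier K. n \<bullet> hat x = 0}" (is "finite ?L")
proof (rule ccontr)
  assume inf: "infinite ?L"
  obtain B where "card B = 3" "B \<subseteq> ?L" using infinite_arbitrarily_large[OF inf] by blast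
  then obtain a b c where abc: "a \<in> ?L" "b \<in> ?L" "c \<in> ?L" "a \<noteq> b" "b \<noteq> c" "a \<noteq> c"
    by (auto simp: card_3_iff)
  \<comment> \<open>Expansion of \<open>n\<close> in the basis dual to \<open>hat a\<close>,
    \<open>hat b\<close>, \<open>hat c\<close>: a nonzero form can vanish at three points only if
    they are collinear.\<close>
  have "D3 (hat a) (hat b) (hat c) *\<^sub>R n =
      (n \<bullet> hat a) *\<^sub>R cross3 (hat b) (hat c) + (n \<bullet> hat b) *\<^sub>R cross3 (hat c) (hat a) + (n \<bullet> hat c) *\<^sub>R cross3 (hat a) (hat b)"
    by (simp add: D3_expand vec_eq_iff forall_3 cross3_def inner_vec_def sum_3 algebra_simps)
  then have "D3 (hat a) (hat b) (hat c) = 0" using abc n by simp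
  moreover have "D3 (hat a) (hat b) (hat c) \<noteq> 0"
    using abc by (intro frontier_det_neq_0[OF K]) auto
  ultimately show False by simp
qed

text \<open>Rays from an interior point with the slopes \<open>0, 1, 2, ...\<close> leave
  \<open>K\<close> at different points.\<close>

lemma infinite_frontier:
  assumes "convex_body K"
  shows "infinite (frontier K)"
proof
  assume fin: "finite (frontier K)"
  obtain z where z: "z \<in> interior K" using assms by (auto simp: convex_body_def)
  have bd: "bounded K" using assms by (simp add: convex_body_def compact_imp_bounded)
  define l :: "nat \<Rightarrow> real^2" where "l k = vector [1, real k]" for k
  have "\<exists>d>0. z + d *\<^sub>R l k \<in> frontier K" for k
  proof -
    have "l k \<noteq> 0" by (auto simp: l_def vec_eq_iff forall_2)
    then show ?thesis using ray_to_frontier[OF bd z] by metis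
  qed
  then obtain d where d: "\<And>k. d k > 0" "\<And>k. z + d k *\<^sub>R l k \<in> frontier K" by metis
  have "inj (\<lambda>k. z + d k *\<^sub>R l k)"
  proof (rule injI)
    fix j k assume "z + d j *\<^sub>R l j = z + d k *\<^sub>R l k"
    then have "d j = d k" "d j * real j = d k * real k" by (auto simp: l_def vec_eq_iff forall_2)
    then show "j = k" using d(1)[of k] by auto
  qed
  moreover have "range (\<lambda>k. z + d k *\<^sub>R l k) \<subseteq> frontier K" using d by auto
  ultimately show False using fin infinite_iff_countable_subset by blast
qed

section \<open>Determinants on curved arcs\<close>

text \<open>Termwise differentiation keeps the disc of convergence. Two derivatives, the second
  continuous at the centre, are what divided differences on an arc consume.\<close>

lemma power_series_derivatives:
  fixes f :: "real \<Rightarrow> real"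
  assumes sums: "\<And>s. \<bar>s - t\<bar> < r \<Longrightarrow> (\<lambda>n. a n * (s - t) ^ n) sums f s" and "r > 0"
  obtains f1 f2 where "\<And>s. \<bar>s - t\<bar> < r \<Longrightarrow> DERIV f s :> f1 s"
    "\<And>s. \<bar>s - t\<bar> < r \<Longrightarrow> DERIV f1 s :> f2 s" "isCont f2 t"
proof -
  define P where "P b s = (\<Sum>n. b n * (s - t) ^ n)" for b :: "nat \<Rightarrow> real" and s
  have sm0: "summable (\<lambda>n. a n * x ^ n)" if "norm x < r" for x
    using sums[of "t + x"] that by (auto simp: sums_iff)
  have sm1: "summable (\<lambda>n. diffs a n * x ^ n)" if "norm x < r" for x
    by (rule termdiff_converges[OF that]) (rule sm0)
  have sm2: "summable (\<lambda>n. diffs (diffs a) n * x ^ n)" if "norm x < r" for x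
    by (rule termdiff_converges[OF that]) (rule sm1)
  have D: "DERIV (P b) s :> P (diffs b) s"
    if "\<And>x. norm x < r \<Longrightarrow> summable (\<lambda>n. b n * x ^ n)" "\<bar>s - t\<bar> < r" for b s
  proof -
    have "((\<lambda>z. \<Sum>n. b n * z^n) has_field_derivative (\<Sum>n. diffs b n * (s + - t)^n)) (at (s + - t))"
      by (rule termdiffs_strong'[where K = r]) (use that in auto)
    from this[unfolded DERIV_shift[of _ _ s "- t"]] show ?thesis by (simp add: P_def[abs_def])
  qed
  have f: "f s = P a s" if "\<bar>s - t\<bar> < r" for s using sums[OF that] by (simp add: sums_iff P_def)
  show ?thesis
  proof (rule that[of "P (diffs a)" "P (diffs (diffs a))"])
    fix s assume s: "\<bar>s - t\<bar> < r"
    show "DERIV f s :> P (diffs a) s"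
      by (rule has_field_derivative_transform_within_open[OF D[OF sm0 s], of "ball t r"])
        (use s in \<open>auto simp: f dist_real_def abs_minus_commute\<close>)
    show "DERIV (P (diffs a)) s :> P (diffs (diffs a)) s" by (rule D[OF sm1 s])
  next
    show "isCont (P (diffs (diffs a))) t" by (rule DERIV_isCont[OF D[OF sm2]]) (use \<open>r > 0\<close> in auto)
  qed
qed

lemma Rolle_second:
  fixes G :: "real \<Rightarrow> real"
  assumes "a < b" "b < c" and G: "G a = 0" "G b = 0" "G c = 0"
    and D: "\<And>x. a \<le> x \<Longrightarrow> x \<le> c \<Longrightarrow> DERIV G x :> G1 x" "\<And>x. a \<le> x \<Longrightarrow> x \<le> c \<Longrightarrow> DERIV G1 x :> G2 x"
  obtains x where "a < x" "x < c" "G2 x = 0"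
proof -
  obtain y where y: "a < y" "y < b" "G b - G a = (b - a) * G1 y"
    using MVT2[of a b G G1] assms by force
  obtain z where z: "b < z" "z < c" "G c - G b = (c - b) * G1 z"
    using MVT2[of b c G G1] assms by force
  have "G1 y = 0" "G1 z = 0" using y z G by auto
  moreover obtain x where x: "y < x" "x < z" "G1 z - G1 y = (z - y) * G2 x"
    using MVT2[of y z G1 G2] D y z by force
  ultimately have "G2 x = 0" using y z by auto
  then show ?thesis using that[of x] x y z by auto
qed

text \<open>\<open>q\<close> is the second divided difference of \<open>f\<close>, and
  \<open>G\<close> is \<open>f\<close> minus its Newton interpolation polynomial at
  \<open>s\<close>, \<open>t\<close>, \<open>u\<close>. Three zeros of \<open>G\<close> give a point
  with \<open>f2 x = 2 * q\<close>; the conclusion is this equation with denominators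
  cleared.\<close>

lemma second_divided_difference:
  fixes f :: "real \<Rightarrow> real"
  assumes D: "\<And>s. \<bar>s - z\<bar> < r \<Longrightarrow> DERIV f s :> f1 s" "\<And>s. \<bar>s - z\<bar> < r \<Longrightarrow> DERIV f1 s :> f2 s"
    and stu: "\<bar>s - z\<bar> \<le> d" "\<bar>t - z\<bar> \<le> d" "\<bar>u - z\<bar> \<le> d" "d < r" "s \<noteq> t" "s \<noteq> u" "t \<noteq> u"
  obtains x where "\<bar>x - z\<bar> \<le> d"
    "(f u - f s) * (t - s) = (f t - f s) * (u - s) + f2 x / 2 * (t - s) * (u - s) * (u - t)"
proof -
  define m where "m = (f t - f s) / (t - s)"
  define q where "q = (f u - f s - (u - s) * m) / ((u - s) * (u - t))"
  define G where "G x = f x - f s - (x - s) * m - (x - s) * (x - t) * q" for x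
  define G1 where "G1 x = f1 x - m - (2 * x - s - t) * q" for x
  define G2 where "G2 x = f2 x - 2 * q" for x
  have DG: "DERIV G x :> G1 x" "DERIV G1 x :> G2 x" if "\<bar>x - z\<bar> < r" for x
    unfolding G_def[abs_def] G1_def[abs_def] G2_def
    by (rule derivative_eq_intros D that refl | simp add: algebra_simps)+
  have zero: "G s = 0" "G t = 0" "G u = 0"
    using stu by (auto simp: G_def m_def q_def)
  note goal = that
  have key: thesis if "a < b" "b < c" "G a = 0" "G b = 0" "G c = 0"
    "\<bar>a - z\<bar> \<le> d" "\<bar>c - z\<bar> \<le> d" for a b c
  proof -
    note abc = that
    have "\<bar>x - z\<bar> < r" if "a \<le> x" "x \<le> c" for x
      using that abc(6,7) stu(4) by linarith
    then have "DERIV G x :> G1 x" "DERIV G1 x :> G2 x" if "a \<le> x" "x \<le> c" for x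
      using DG that by auto
    from Rolle_second[OF abc(1-5) this] obtain x where x: "a < x" "x < c" "G2 x = 0"
      by metis
    then have q: "f2 x / 2 = q" by (simp add: G2_def)
    have E: "f u - f s = q * ((u - s) * (u - t)) + (u - s) * m" using stu by (simp add: q_def)
    have "(f u - f s) * (t - s) = (u - s) * (m * (t - s)) + q * (t - s) * (u - s) * (u - t)"
      unfolding E by (simp add: algebra_simps)
    moreover have "m * (t - s) = f t - f s" using stu by (simp add: m_def)
    ultimately have "(f u - f s) * (t - s) = (f t - f s) * (u - s) + f2 x / 2 * (t - s) * (u - s) * (u - t)"
      unfolding q by (simp add: mult.commute)
    moreover have "\<bar>x - z\<bar> \<le> d" using x abc by linarith
    ultimately show thesis by (intro goal)
  qed
  \<comment> \<open>\<open>Rolle_second\<close> takes the zeros in increasing order, while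
    \<open>G\<close> stays the same for all six orders.\<close>
  consider "s < t" "t < u" | "s < u" "u < t" | "t < s" "s < u" | "t < u" "u < s" | "u < s" "s < t" | "u < t" "t < s"
    using stu(5-7) by linarith
  then show thesis
  proof cases
    case 1 then show thesis using key[of s t u] zero stu by simp
  next
    case 2 then show thesis using key[of s u t] zero stu by simp
  next
    case 3 then show thesis using key[of t s u] zero stu by simp
  next
    case 4 then show thesis using key[of t u s] zero stu by simp
  next
    case 5 then show thesis using key[of u s t] zero stu by simp
  next
    case 6 then show thesis using key[of u t s] zero stu by simp
  qed
qed


lemma first_divided_difference:
  fixes f :: "real \<Rightarrow> real"
  assumes D: "\<And>s. \<bar>s - z\<bar> < r \<Longrightarrow> DERIV f s :> f1 s"
    and st: "\<bar>s - z\<bar> \<le> d" "\<bar>t - z\<bar> \<le> d" "d < r" "s \<noteq> t"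
  obtains x where "\<bar>x - z\<bar> \<le> d" "f t - f s = (t - s) * f1 x"
proof -
  have key: "\<exists>x. \<bar>x - z\<bar> \<le> d \<and> f b - f a = (b - a) * f1 x"
    if "a < b" "\<bar>a - z\<bar> \<le> d" "\<bar>b - z\<bar> \<le> d" for a b
  proof -
    have "DERIV f x :> f1 x" if "a \<le> x" "x \<le> b" for x
      using that \<open>\<bar>a - z\<bar> \<le> d\<close> \<open>\<bar>b - z\<bar> \<le> d\<close> st(3) by (intro D) linarith
    then obtain x where x: "a < x" "x < b" "f b - f a = (b - a) * f1 x"
      using MVT2[OF \<open>a < b\<close>, of f f1] by blast
    then have "\<bar>x - z\<bar> \<le> d" using that by linarith
    then show ?thesis using x by blast
  qed
  show thesis
  proof (cases "s < t")
    case True then show thesis using key[of s t] st that by blast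
  next
    case False
    then obtain x where "\<bar>x - z\<bar> \<le> d" "f s - f t = (s - t) * f1 x" using key[of t s] st by auto
    then show thesis using that[of x] by (simp add: algebra_simps)
  qed
qed

lemma has_vector_derivative_real2:
  fixes \<gamma> :: "real \<Rightarrow> real^2"
  assumes "DERIV (\<lambda>s. \<gamma> s $ 1) t :> v $ 1" "DERIV (\<lambda>s. \<gamma> s $ 2) t :> v $ 2"
  shows "(\<gamma> has_vector_derivative v) (at t)"
proof -
  have *: "w = w $ 1 *\<^sub>R axis 1 1 + w $ 2 *\<^sub>R axis 2 1" for w :: "real^2"
    by (simp add: vec_eq_iff forall_2 axis_def)
  have "((\<lambda>s. \<gamma> s $ 1 *\<^sub>R axis 1 1 + \<gamma> s $ 2 *\<^sub>R axis 2 1) has_vector_derivative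
     (v $ 1 *\<^sub>R axis 1 1 + v $ 2 *\<^sub>R axis 2 (1::real) :: real^2)) (at t)"
    using has_vector_derivative_scaleR[OF assms(1) has_vector_derivative_const]
      has_vector_derivative_scaleR[OF assms(2) has_vector_derivative_const]
    by (intro has_vector_derivative_add) simp_all
  then show ?thesis unfolding *[symmetric] .
qed

text \<open>For the conic \<open>y = x\<^sup>2\<close> the determinant of three points is the Vandermonde determinant of
  their parameters; on an arc of nonzero curvature this holds asymptotically up to a constant.\<close>

lemma arc_det_asymptotics:
  fixes \<gamma> :: "real \<Rightarrow> real^2"
  assumes "real_analytic_on \<gamma> I" "z \<in> I" "curvature \<gamma> z > 0"
  obtains h \<kappa> r where "\<kappa> \<noteq> 0" "r > 0" "(h \<longlongrightarrow> \<kappa>) (nhds (z, z, z))"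
    "\<And>s t u. \<lbrakk>\<bar>s - z\<bar> < r; \<bar>t - z\<bar> < r; \<bar>u - z\<bar> < r\<rbrakk> \<Longrightarrow>
       D3 (hat (\<gamma> s)) (hat (\<gamma> t)) (hat (\<gamma> u)) = (t - s) * (u - s) * (u - t) * h (s, t, u)"
proof -
  obtain r c where r: "r > 0" and sums: "\<And>s. \<bar>s - z\<bar> < r \<Longrightarrow> (\<lambda>n. (s - z) ^ n *\<^sub>R c n) sums \<gamma> s"
    using assms(1,2) unfolding real_analytic_on_def by blast
  have comp: "(\<lambda>n. c n $ i * (s - z) ^ n) sums (\<gamma> s $ i)" if "\<bar>s - z\<bar> < r" for s i
    using bounded_linear.sums[OF bounded_linear_vec_nth sums[OF that], of i] by (simp add: mult.commute)
  obtain f1 f2 where f: "\<And>s. \<bar>s - z\<bar> < r \<Longrightarrow> DERIV (\<lambda>s. \<gamma> s $ 1) s :> f1 s"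
    "\<And>s. \<bar>s - z\<bar> < r \<Longrightarrow> DERIV f1 s :> f2 s" "isCont f2 z"
    using power_series_derivatives[OF comp r] by blast
  obtain g1 g2 where g: "\<And>s. \<bar>s - z\<bar> < r \<Longrightarrow> DERIV (\<lambda>s. \<gamma> s $ 2) s :> g1 s"
    "\<And>s. \<bar>s - z\<bar> < r \<Longrightarrow> DERIV g1 s :> g2 s" "isCont g2 z"
    using power_series_derivatives[OF comp r] by blast
  define v where "v s = (vector [f1 s, g1 s] :: real^2)" for s
  have vd: "vector_derivative \<gamma> (at s) = v s" if "\<bar>s - z\<bar> < r" for s
    by (rule vector_derivative_at, rule has_vector_derivative_real2) (use f g that in \<open>simp_all add: v_def\<close>)
  have "(v has_vector_derivative vector [f2 z, g2 z]) (at z)"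
    by (rule has_vector_derivative_real2) (use f g r in \<open>simp_all add: v_def\<close>)
  then have "((\<lambda>s. vector_derivative \<gamma> (at s)) has_vector_derivative vector [f2 z, g2 z]) (at z)"
    by (rule has_vector_derivative_transform_within_open[where S = "ball z r"])
      (use vd r in \<open>auto simp: dist_real_def abs_minus_commute\<close>)
  then have vd2: "vector_derivative (\<lambda>s. vector_derivative \<gamma> (at s)) (at z) = vector [f2 z, g2 z]"
    by (rule vector_derivative_at)
  have nz: "f1 z * g2 z - g1 z * f2 z \<noteq> 0"
    using assms(3) r unfolding curvature_def by (auto simp: Let_def vd2 vd v_def)
  \<comment> \<open>A common bound for the distances of the three parameters from \<open>z\<close>;
    all mean value points stay within it, so they tend to \<open>z\<close> with it.\<close>
  define m where "m p = (case p of (s, t, u) \<Rightarrow> \<bar>s - z\<bar> + \<bar>t - z\<bar> + \<bar>u - z\<bar>)" for p :: "real \<times> real \<times> real"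
  define near where "near p x \<longleftrightarrow> \<bar>x - z\<bar> \<le> m p" for p x
  define formula where "formula p x1 x2 x3 x4 \<longleftrightarrow> (m p < r \<longrightarrow>
      (case p of (s, t, u) \<Rightarrow> D3 (hat (\<gamma> s)) (hat (\<gamma> t)) (hat (\<gamma> u)) =
        (t - s) * (u - s) * (u - t) * ((f1 x1 * g2 x4 - g1 x2 * f2 x3) / 2)))" for p x1 x2 x3 x4
  have ex: "\<exists>x1 x2 x3 x4. near p x1 \<and> near p x2 \<and> near p x3 \<and> near p x4 \<and> formula p x1 x2 x3 x4" for p
  proof -
    obtain s t u where p: "p = (s, t, u)" by (cases p) auto
    have "m p \<ge> 0" by (simp add: m_def p)
    then have near_z: "near p z" by (simp add: near_def)
    show ?thesis
    proof (cases "m p < r \<and> s \<noteq> t \<and> s \<noteq> u \<and> t \<noteq> u")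
      case False
      \<comment> \<open>Beyond the radius \<open>formula\<close> claims nothing, and for coinciding
        parameters both sides vanish, so \<open>z\<close> itself can be chosen.\<close>
      then show ?thesis using near_z by (intro exI[of _ z]) (auto simp: p formula_def)
    next
      case True
      have b: "\<bar>s - z\<bar> \<le> m p" "\<bar>t - z\<bar> \<le> m p" "\<bar>u - z\<bar> \<le> m p" by (simp_all add: m_def p)
      obtain x1 where x1: "near p x1" "\<gamma> t $ 1 - \<gamma> s $ 1 = (t - s) * f1 x1"
        using first_divided_difference[OF f(1) b(1,2)] True unfolding near_def by blast
      obtain x2 where x2: "near p x2" "\<gamma> t $ 2 - \<gamma> s $ 2 = (t - s) * g1 x2"
        using first_divided_difference[OF g(1) b(1,2)] True unfolding near_def by blast
      obtain x3 where x3: "near p x3"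
        "(\<gamma> u $ 1 - \<gamma> s $ 1) * (t - s) = (\<gamma> t $ 1 - \<gamma> s $ 1) * (u - s) + f2 x3 / 2 * (t - s) * (u - s) * (u - t)"
        using second_divided_difference[OF f(1,2) b] True unfolding near_def by blast
      obtain x4 where x4: "near p x4"
        "(\<gamma> u $ 2 - \<gamma> s $ 2) * (t - s) = (\<gamma> t $ 2 - \<gamma> s $ 2) * (u - s) + g2 x4 / 2 * (t - s) * (u - s) * (u - t)"
        using second_divided_difference[OF g(1,2) b] True unfolding near_def by blast
      \<comment> \<open>The first-order terms cancel in the 2x2 determinant of differences and leave
        the second-order ones. The extra factor \<open>p\<close>, here \<open>t - s\<close>, clears
        denominators.\<close>
      have alg: "(p * F) * ((p * G) * q + a / 2 * p * q * w) - (p * G) * ((p * F) * q + b / 2 * p * q * w)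
          = p * (p * q * w * ((F * a - G * b) / 2))" for p q w F G a b :: real
        by (simp add: field_simps)
      have ts: "t - s \<noteq> 0" using True by simp
      have "(t - s) * D3 (hat (\<gamma> s)) (hat (\<gamma> t)) (hat (\<gamma> u)) =
          (\<gamma> t $ 1 - \<gamma> s $ 1) * ((\<gamma> u $ 2 - \<gamma> s $ 2) * (t - s)) - (\<gamma> t $ 2 - \<gamma> s $ 2) * ((\<gamma> u $ 1 - \<gamma> s $ 1) * (t - s))"
        by (simp add: D3_expand algebra_simps)
      also have "\<dots> = (t - s) * ((t - s) * (u - s) * (u - t) * ((f1 x1 * g2 x4 - g1 x2 * f2 x3) / 2))"
        unfolding x3(2) x4(2) x1(2) x2(2) by (rule alg)
      finally have "D3 (hat (\<gamma> s)) (hat (\<gamma> t)) (hat (\<gamma> u)) =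
          (t - s) * (u - s) * (u - t) * ((f1 x1 * g2 x4 - g1 x2 * f2 x3) / 2)"
        using ts by simp
      then have "near p x1 \<and> near p x2 \<and> near p x3 \<and> near p x4 \<and> formula p x1 x2 x3 x4"
        using x1(1) x2(1) x3(1) x4(1) by (simp add: p formula_def)
      then show ?thesis by blast
    qed
  qed
  obtain x1 x2 x3 x4 where x: "\<And>p. near p (x1 p)" "\<And>p. near p (x2 p)" "\<And>p. near p (x3 p)" "\<And>p. near p (x4 p)"
    "\<And>p. formula p (x1 p) (x2 p) (x3 p) (x4 p)"
    using ex by metis
  have m0: "(m \<longlongrightarrow> 0) (nhds (z, z, z))"
  proof -
    have "((\<lambda>p. \<bar>fst p - z\<bar> + \<bar>fst (snd p) - z\<bar> + \<bar>snd (snd p) - z\<bar>) \<longlongrightarrow>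
        \<bar>fst (z, z, z) - z\<bar> + \<bar>fst (snd (z, z, z)) - z\<bar> + \<bar>snd (snd (z, z, z)) - z\<bar>) (nhds (z, z, z))"
      by (intro tendsto_intros filterlim_ident)
    moreover have "m = (\<lambda>p. \<bar>fst p - z\<bar> + \<bar>fst (snd p) - z\<bar> + \<bar>snd (snd p) - z\<bar>)"
      by (auto simp: m_def)
    ultimately show ?thesis by simp
  qed
  have lim: "(x \<longlongrightarrow> z) (nhds (z, z, z))" if "\<And>p. near p (x p)" for x
    by (rule LIM_zero_cancel, rule tendsto_0_le[OF m0, of _ 1])
      (use that in \<open>auto simp: near_def intro!: always_eventually order_trans[OF _ abs_ge_self]\<close>)
  have cont: "isCont f1 z" "isCont g1 z"
    using f(2)[of z] g(2)[of z] r by (auto intro: DERIV_isCont)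
  have "((\<lambda>p. (f1 (x1 p) * g2 (x4 p) - g1 (x2 p) * f2 (x3 p)) / 2) \<longlongrightarrow> (f1 z * g2 z - g1 z * f2 z) / 2) (nhds (z, z, z))"
    using isCont_tendsto_compose[OF cont(1) lim[OF x(1)]] isCont_tendsto_compose[OF cont(2) lim[OF x(2)]]
      isCont_tendsto_compose[OF f(3) lim[OF x(3)]] isCont_tendsto_compose[OF g(3) lim[OF x(4)]]
    by (intro tendsto_divide tendsto_diff tendsto_mult tendsto_const) simp_all
  \<comment> \<open>\<open>r / 3\<close> keeps the sum \<open>m\<close> of three distances below
    \<open>r\<close>. The limit is half the determinant of the first two derivatives, nonzero by the
    curvature.\<close>
  then show thesis
    using that[of "(f1 z * g2 z - g1 z * f2 z) / 2" "r / 3" "\<lambda>p. (f1 (x1 p) * g2 (x4 p) - g1 (x2 p) * f2 (x3 p)) / 2"]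
      nz r x(5) by (auto simp: m_def formula_def)
qed

section \<open>The conic through five points\<close>

text \<open>For fixed \<open>x1, \<dots>, x5\<close> the equation \<open>pencil1 = pencil2\<close> in the unknown \<open>x6\<close> is that of the conic through
  \<open>x1, \<dots>, x5\<close>. Each point occurs twice on either side, so the quotient is a projective invariant.\<close>

definition pencil1 :: "(nat \<Rightarrow> real^3) \<Rightarrow> real" where
  "pencil1 x = D3 (x 1) (x 2) (x 6) * D3 (x 3) (x 4) (x 6) * D3 (x 1) (x 3) (x 5) * D3 (x 2) (x 4) (x 5)"

definition pencil2 :: "(nat \<Rightarrow> real^3) \<Rightarrow> real" where
  "pencil2 x = D3 (x 1) (x 3) (x 6) * D3 (x 2) (x 4) (x 6) * D3 (x 1) (x 2) (x 5) * D3 (x 3) (x 4) (x 5)"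

text \<open>Both pencils change by the common factor \<open>p\<^sup>2 / det A ^ 4\<close>. The
  cross-multiplied form also covers vanishing scale factors and vanishing pencils.\<close>

lemma pencil_scale:
  assumes "\<And>i. i \<in> {1..6} \<Longrightarrow> A *v v i = s i *\<^sub>R w i" "det A \<noteq> 0"
  shows "pencil1 v * pencil2 w = pencil2 v * pencil1 w"
proof -
  have D: "det A * D3 (v i) (v j) (v k) = s i * s j * s k * D3 (w i) (w j) (w k)"
    if "i \<in> {1..6}" "j \<in> {1..6}" "k \<in> {1..6}" for i j k
    using D3_matrix[of A "v i" "v j" "v k"] assms(1) that by (simp add: mult_ac)
  define p where "p = s 1 * s 2 * s 3 * s 4 * s 5 * s 6"
  have "det A ^ 4 * pencil1 v = (det A * D3 (v 1) (v 2) (v 6)) * (det A * D3 (v 3) (v 4) (v 6)) *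
      (det A * D3 (v 1) (v 3) (v 5)) * (det A * D3 (v 2) (v 4) (v 5))"
    by (simp add: pencil1_def power4_eq_xxxx)
  also have "\<dots> = p\<^sup>2 * pencil1 w"
    by (simp add: D pencil1_def p_def power2_eq_square)
  finally have 1: "det A ^ 4 * pencil1 v = p\<^sup>2 * pencil1 w" .
  have "det A ^ 4 * pencil2 v = (det A * D3 (v 1) (v 3) (v 6)) * (det A * D3 (v 2) (v 4) (v 6)) *
      (det A * D3 (v 1) (v 2) (v 5)) * (det A * D3 (v 3) (v 4) (v 5))"
    by (simp add: pencil2_def power4_eq_xxxx)
  also have "\<dots> = p\<^sup>2 * pencil2 w"
    by (simp add: D pencil2_def p_def power2_eq_square)
  finally have 2: "det A ^ 4 * pencil2 v = p\<^sup>2 * pencil2 w" .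
  have "det A ^ 4 * (pencil1 v * pencil2 w) = det A ^ 4 * (pencil2 v * pencil1 w)"
    using 1 2 by (metis mult.assoc mult.commute)
  then show ?thesis using assms(2) by simp
qed

lemma tendsto_pencil:
  assumes "\<And>i. i \<in> {1..6} \<Longrightarrow> ((\<lambda>F. v F i) \<longlongrightarrow> x i) \<F>"
  shows "((\<lambda>F. pencil1 (v F)) \<longlongrightarrow> pencil1 x) \<F>" "((\<lambda>F. pencil2 (v F)) \<longlongrightarrow> pencil2 x) \<F>"
  unfolding pencil1_def pencil2_def by (intro tendsto_intros assms; simp)+

text \<open>Both pencils contain the parameter differences of the same twelve pairs, collected in
  \<open>V\<close>, which is nonzero for distinct points. What remains on either side is a product
  of four values of \<open>h\<close>, each tending to \<open>\<kappa>\<close>.\<close>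

lemma pencil_quotient_tendsto_1:
  fixes Y :: "'i \<Rightarrow> nat \<Rightarrow> real^2"
  assumes "positively_curved S" "y \<in> S"
    and lim: "\<And>i. i \<in> {1..6} \<Longrightarrow> ((\<lambda>F. Y F i) \<longlongrightarrow> y) \<F>"
    and inS: "\<And>i. i \<in> {1..6} \<Longrightarrow> \<forall>\<^sub>F F in \<F>. Y F i \<in> S"
    and dist: "\<forall>\<^sub>F F in \<F>. inj_on (Y F) {1..6}"
  shows "((\<lambda>F. pencil1 (\<lambda>i. hat (Y F i)) / pencil2 (\<lambda>i. hat (Y F i))) \<longlongrightarrow> 1) \<F>"
    and "\<forall>\<^sub>F F in \<F>. pencil2 (\<lambda>i. hat (Y F i)) \<noteq> 0"
proof -
  obtain \<gamma> I U z where \<gamma>: "analytic_param S \<gamma> I U" "z \<in> I" "\<gamma> z = y" "curvature \<gamma> z > 0"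
    using assms(1,2) unfolding positively_curved_def by blast
  obtain g where g: "homeomorphism I (S \<inter> U) \<gamma> g" using \<gamma>(1) unfolding analytic_param_def by blast
  have "open U" using \<gamma>(1) by (simp add: analytic_param_def)
  have yU: "y \<in> S \<inter> U" using g \<gamma> by (auto simp: homeomorphism_def)
  obtain h \<kappa> r where h: "\<kappa> \<noteq> 0" "r > 0" "(h \<longlongrightarrow> \<kappa>) (nhds (z, z, z))"
    "\<And>s t u. \<lbrakk>\<bar>s - z\<bar> < r; \<bar>t - z\<bar> < r; \<bar>u - z\<bar> < r\<rbrakk> \<Longrightarrow>
       D3 (hat (\<gamma> s)) (hat (\<gamma> t)) (hat (\<gamma> u)) = (t - s) * (u - s) * (u - t) * h (s, t, u)"
    using arc_det_asymptotics \<gamma> unfolding analytic_param_def by metis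
  \<comment> \<open>Here \<open>g\<close> is the continuous inverse of the parametrization, so
    points tending to \<open>y\<close> have parameters tending to \<open>z\<close>.\<close>
  define s where "s F i = g (Y F i)" for F i
  have inU: "\<forall>\<^sub>F F in \<F>. Y F i \<in> S \<inter> U" if "i \<in> {1..6}" for i
    using inS[OF that] topological_tendstoD[OF lim[OF that] \<open>open U\<close>] yU by (auto elim: eventually_elim2)
  have gz: "g y = z" using g \<gamma> by (auto simp: homeomorphism_def)
  have slim: "((\<lambda>F. s F i) \<longlongrightarrow> z) \<F>" if "i \<in> {1..6}" for i
    unfolding s_def gz[symmetric]
    by (rule continuous_on_tendsto_compose[OF homeomorphism_cont2[OF g] lim[OF that] yU inU[OF that]])
  have \<gamma>s: "\<forall>\<^sub>F F in \<F>. \<gamma> (s F i) = Y F i" if "i \<in> {1..6}" for i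
    using inU[OF that] by eventually_elim (use g in \<open>auto simp: homeomorphism_def s_def\<close>)
  have near: "\<forall>\<^sub>F F in \<F>. \<bar>s F i - z\<bar> < r" if "i \<in> {1..6}" for i
    using tendstoD[OF slim[OF that] \<open>r > 0\<close>] by (simp add: dist_real_def)
  define H where "H F i j k = h (s F i, s F j, s F k)" for F i j k
  have Hlim: "((\<lambda>F. H F i j k) \<longlongrightarrow> \<kappa>) \<F>" if "i \<in> {1..6}" "j \<in> {1..6}" "k \<in> {1..6}" for i j k
    unfolding H_def by (rule filterlim_compose[OF h(3)]) (intro tendsto_Pair slim that)
  define V where "V F = (let s = s F in (s 2 - s 1) * (s 6 - s 1) * (s 6 - s 2) * (s 4 - s 3) * (s 6 - s 3) * (s 6 - s 4)
     * (s 3 - s 1) * (s 5 - s 1) * (s 5 - s 3) * (s 4 - s 2) * (s 5 - s 2) * (s 5 - s 4))" for F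
  define H1 where "H1 F = H F 1 2 6 * H F 3 4 6 * H F 1 3 5 * H F 2 4 5" for F
  define H2 where "H2 F = H F 1 3 6 * H F 2 4 6 * H F 1 2 5 * H F 3 4 5" for F
  have all: "\<forall>\<^sub>F F in \<F>. \<forall>i\<in>{1..6}. \<gamma> (s F i) = Y F i \<and> \<bar>s F i - z\<bar> < r"
    by (intro eventually_ball_finite ballI eventually_conj \<gamma>s near) auto
  have main: "\<forall>\<^sub>F F in \<F>. V F \<noteq> 0 \<and> pencil1 (\<lambda>i. hat (Y F i)) = V F * H1 F \<and> pencil2 (\<lambda>i. hat (Y F i)) = V F * H2 F"
    using all dist
  proof eventually_elim
    case (elim F)
    have D: "D3 (hat (Y F i)) (hat (Y F j)) (hat (Y F k)) =
        (s F j - s F i) * (s F k - s F i) * (s F k - s F j) * H F i j k"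
      if "i \<in> {1..6}" "j \<in> {1..6}" "k \<in> {1..6}" for i j k
      using h(4)[of "s F i" "s F j" "s F k"] elim(1) that by (simp add: H_def)
    have "inj_on (s F) {1..6}"
    proof (rule inj_onI)
      fix i j assume "i \<in> {1..6}" "j \<in> {1..6}" "s F i = s F j"
      then have "Y F i = Y F j" using elim(1) by metis
      then show "i = j" using elim(2) \<open>i \<in> _\<close> \<open>j \<in> _\<close> by (auto dest: inj_onD)
    qed
    then have "s F i - s F j \<noteq> 0" if "i \<in> {1..6}" "j \<in> {1..6}" "i \<noteq> j" for i j
      using that by (auto dest: inj_onD)
    then have "V F \<noteq> 0" by (simp add: V_def Let_def)
    moreover have "pencil1 (\<lambda>i. hat (Y F i)) = V F * H1 F"
      by (simp add: pencil1_def D V_def H1_def Let_def mult.assoc mult.left_commute)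
    moreover have "pencil2 (\<lambda>i. hat (Y F i)) = V F * H2 F"
      by (simp add: pencil2_def D V_def H2_def Let_def mult.assoc mult.left_commute)
    ultimately show ?case by simp
  qed
  have H12: "(H1 \<longlongrightarrow> \<kappa> * \<kappa> * \<kappa> * \<kappa>) \<F>" "(H2 \<longlongrightarrow> \<kappa> * \<kappa> * \<kappa> * \<kappa>) \<F>"
    unfolding H1_def[abs_def] H2_def[abs_def] by (intro tendsto_mult Hlim; simp)+
  have k4: "\<kappa> * \<kappa> * \<kappa> * \<kappa> \<noteq> 0" using h(1) by simp
  have H2nz: "\<forall>\<^sub>F F in \<F>. H2 F \<noteq> 0" using tendsto_imp_eventually_ne[OF H12(2) k4] .
  show "\<forall>\<^sub>F F in \<F>. pencil2 (\<lambda>i. hat (Y F i)) \<noteq> 0"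
    using main H2nz by eventually_elim simp
  have "((\<lambda>F. H1 F / H2 F) \<longlongrightarrow> (\<kappa> * \<kappa> * \<kappa> * \<kappa>) / (\<kappa> * \<kappa> * \<kappa> * \<kappa>)) \<F>"
    by (rule tendsto_divide[OF H12 k4])
  then have "((\<lambda>F. H1 F / H2 F) \<longlongrightarrow> 1) \<F>" using k4 by simp
  then show "((\<lambda>F. pencil1 (\<lambda>i. hat (Y F i)) / pencil2 (\<lambda>i. hat (Y F i))) \<longlongrightarrow> 1) \<F>"
    by (rule Lim_transform_eventually) (use main in \<open>eventually_elim, simp\<close>)
qed

text \<open>The boundary is connected because \<open>K\<close> has dimension two, and it is
  infinite, so it has no isolated points.\<close>

lemma islimpt_frontier_convex_body:
  assumes "convex_body K" "x \<in> frontier K"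
  shows "x islimpt frontier K"
proof -
  have K: "compact K" "convex K" "interior K \<noteq> {}" using assms(1) by (auto simp: convex_body_def)
  have "aff_dim K = 2" using aff_dim_nonempty_interior[OF K(3)] by simp
  then have "connected (rel_frontier K)"
    using K by (intro connected_sphere_gen compact_imp_bounded) auto
  then have "connected (frontier K)" using K(3) by (simp add: rel_frontier_nonempty_interior)
  then show ?thesis using assms infinite_frontier[OF assms(1)]
    by (intro connected_imp_perfect) auto
qed

lemma quadratic_form_coefficients:
  fixes m n p q :: "real^3"
  obtains a b c d e f where "\<And>x. \<alpha> * (m \<bullet> hat x) * (n \<bullet> hat x) - \<beta> * (p \<bullet> hat x) * (q \<bullet> hat x) =
    a * (x $ 1)\<^sup>2 + b * (x $ 1) * (x $ 2) + c * (x $ 2)\<^sup>2 + d * (x $ 1) + e * (x $ 2) + f"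
  by (rule that[of "\<alpha> * m$1 * n$1 - \<beta> * p$1 * q$1" "\<alpha> * (m$1 * n$2 + m$2 * n$1) - \<beta> * (p$1 * q$2 + p$2 * q$1)"
     "\<alpha> * m$2 * n$2 - \<beta> * p$2 * q$2" "\<alpha> * (m$1 * n$3 + m$3 * n$1) - \<beta> * (p$1 * q$3 + p$3 * q$1)"
     "\<alpha> * (m$2 * n$3 + m$3 * n$2) - \<beta> * (p$2 * q$3 + p$3 * q$2)" "\<alpha> * m$3 * n$3 - \<beta> * p$3 * q$3"])
    (simp add: inner_vec_def sum_3 algebra_simps power2_eq_square)

text \<open>With five boundary points fixed, the identity becomes a quadratic equation
  \<open>Q p = 0\<close> for the sixth. It extends to the finite set \<open>E\<close> because
  boundary points are limits of other boundary points.\<close>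

lemma pencil_identity_imp_conic:
  assumes K: "convex_body K" "strictly_convex K" and E: "finite E"
    and eq: "\<And>x. inj_on x {1..6} \<Longrightarrow> x ` {1..6} \<subseteq> frontier K - E \<Longrightarrow>
      pencil1 (\<lambda>i. hat (x i)) = pencil2 (\<lambda>i. hat (x i))"
  shows "\<not> non_conic (frontier K)"
proof -
  have inf: "infinite (frontier K - E)" using infinite_frontier[OF K(1)] E by simp
  then obtain B where B: "finite B" "card B = 5" "B \<subseteq> frontier K - E"
    using infinite_arbitrarily_large by blast
  obtain x :: "nat \<Rightarrow> real^2" where x: "bij_betw x {1..5} B"
    using ex_bij_betw_nat_finite_1[OF B(1)] B(2) by auto
  define z where "z i = hat (x i)" for i
  have xfr: "x i \<in> frontier K - E" if "i \<in> {1..5}" for i using bij_betwE[OF x] B(3) that by blast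
  have xne: "x i \<noteq> x j" if "i \<in> {1..5}" "j \<in> {1..5}" "i \<noteq> j" for i j
    using x that by (auto simp: bij_betw_def dest: inj_onD)
  define Q where "Q p = pencil1 (\<lambda>i. hat ((x(6 := p)) i)) - pencil2 (\<lambda>i. hat ((x(6 := p)) i))" for p
  have Q: "Q p = D3 (z 1) (z 3) (z 5) * D3 (z 2) (z 4) (z 5) * (cross3 (z 1) (z 2) \<bullet> hat p) * (cross3 (z 3) (z 4) \<bullet> hat p)
      - D3 (z 1) (z 2) (z 5) * D3 (z 3) (z 4) (z 5) * (cross3 (z 1) (z 3) \<bullet> hat p) * (cross3 (z 2) (z 4) \<bullet> hat p)" for p
    by (simp add: Q_def pencil1_def pencil2_def z_def flip: D3_def)
  obtain a b c d e f where abc: "\<And>p. Q p = a * (p $ 1)\<^sup>2 + b * (p $ 1) * (p $ 2) + c * (p $ 2)\<^sup>2 + d * (p $ 1) + e * (p $ 2) + f"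
    unfolding Q using quadratic_form_coefficients by blast
  have Q0: "Q p = 0" if "p \<in> frontier K - E" for p
  proof (cases "p \<in> x ` {1..5}")
    case True
    have "{1..5} = {1, 2, 3, 4, 5::nat}" by auto
    then have "p = x 1 \<or> p = x 2 \<or> p = x 3 \<or> p = x 4 \<or> p = x 5" using True by auto
    \<comment> \<open>At \<open>x 1\<close> to \<open>x 4\<close> both products have a vanishing
      determinant; at \<open>x 5\<close> the two products coincide.\<close>
    then show ?thesis
      unfolding Q D3_def[symmetric] by (auto simp: z_def[symmetric])
  next
    case False
    have six: "{1..6} = insert 6 {1..5::nat}" by auto
    have "inj_on (x(6 := p)) {1..6}"
      using x False unfolding six by (auto simp: bij_betw_def inj_on_def)
    moreover have "(x(6 := p)) ` {1..6} \<subseteq> frontier K - E"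
      using that xfr unfolding six by auto
    ultimately have "pencil1 (\<lambda>i. hat ((x(6 := p)) i)) = pencil2 (\<lambda>i. hat ((x(6 := p)) i))"
      by (rule eq)
    then show ?thesis by (simp only: Q_def diff_self)
  qed
  have Qfr: "Q p = 0" if "p \<in> frontier K" for p
  proof -
    have "p islimpt frontier K" by (rule islimpt_frontier_convex_body[OF K(1) that])
    then have "p islimpt (frontier K - E) \<union> E" by (rule islimpt_subset) auto
    then have "p islimpt frontier K - E" using islimpt_Un_finite[OF E] by (metis sup_commute)
    moreover have "closed {p. Q p = 0}"
      unfolding abc by (intro closed_Collect_eq continuous_intros)
    moreover have "frontier K - E \<subseteq> {p. Q p = 0}" using Q0 by auto
    ultimately show ?thesis using closed_limpt islimpt_subset by blast
  qed
  have nz: "D3 (z i) (z j) (z k) \<noteq> 0" if "i \<in> {1..5}" "j \<in> {1..5}" "k \<in> {1..5}" "i \<noteq> j" "j \<noteq> k" "i \<noteq> k" for i j k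
    unfolding z_def using that xfr xne by (intro frontier_det_neq_0[OF K]) auto
  \<comment> \<open>Without quadratic part \<open>Q\<close> is a linear form vanishing on the
    infinite boundary, hence zero everywhere. But at the midpoint of \<open>x 1\<close> and
    \<open>x 2\<close> the first product vanishes and the second does not.\<close>
  have "(a, b, c) \<noteq> (0, 0, 0)"
  proof
    assume 0: "(a, b, c) = (0, 0, 0)"
    define n :: "real^3" where "n = vector [d, e, f]"
    have Qn: "Q p = n \<bullet> hat p" for p using 0 by (simp add: abc n_def inner_vec_def sum_3)
    then have "{p \<in> frontier K. n \<bullet> hat p = 0} = frontier K" using Qfr by auto
    then have "n = 0"
      using finite_frontier_line[OF K, of n] infinite_frontier[OF K(1)] by metis
    then have "Q (midpoint (x 1) (x 2)) = 0" using Qn by simp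
    moreover have "hat (midpoint (x 1) (x 2)) = (1/2) *\<^sub>R z 1 + (1/2) *\<^sub>R z 2"
      by (simp add: z_def midpoint_def vec_eq_iff forall_3)
    ultimately show False unfolding Q D3_def[symmetric] using nz by (simp add: D3_add)
  qed
  then have "conic {p. a * (p $ 1)\<^sup>2 + b * (p $ 1) * (p $ 2) + c * (p $ 2)\<^sup>2 + d * (p $ 1) + e * (p $ 2) + f = 0}"
    unfolding conic_def by blast
  moreover have "frontier K \<subseteq> {p. a * (p $ 1)\<^sup>2 + b * (p $ 1) * (p $ 2) + c * (p $ 2)\<^sup>2 + d * (p $ 1) + e * (p $ 2) + f = 0}"
    using Qfr by (auto simp: abc)
  ultimately show ?thesis unfolding non_conic_def by blast
qed

section \<open>Projective frames and tracked points\<close>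

lemma tendsto_cross3 [tendsto_intros]:
  "(f \<longlongrightarrow> a) F \<Longrightarrow> (g \<longlongrightarrow> b) F \<Longrightarrow> ((\<lambda>x. cross3 (f x) (g x)) \<longlongrightarrow> cross3 a b) F"
  unfolding cross3_def vector_def by (intro vec_tendstoI) (auto simp: forall_3 intro!: tendsto_intros)

text \<open>Cramer's rule: the coefficients in \<open>f\<close> are the coordinates of
  \<open>x\<close> in the basis \<open>a\<close>, \<open>b\<close>, \<open>c\<close>.\<close>

lemma frame_matrix:
  assumes "D3 a b c \<noteq> 0"
  obtains A :: "real^3^3" where "A *v a = u" "A *v b = v" "A *v c = w"
proof -
  define f where "f x = (D3 x b c / D3 a b c) *\<^sub>R u + (D3 a x c / D3 a b c) *\<^sub>R v + (D3 a b x / D3 a b c) *\<^sub>R w" for x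
  have "linear f"
    by (intro linearI) (simp_all add: f_def D3_add D3_scale add_divide_distrib algebra_simps)
  then have "matrix f *v x = f x" for x by (metis matrix_vector_mul(2))
  then show ?thesis using assms by (intro that[of "matrix f"]) (simp_all add: f_def)
qed

text \<open>How large \<open>F\<close> has to be may depend on the triple, so an argument can use
  only finitely many triples at a time.\<close>

locale asymptotic_embedding =
  fixes K K' :: "(real^2) set" and \<F> :: "'i filter" and g :: "'i \<Rightarrow> real^2 \<Rightarrow> real^2"
  assumes convex_K: "convex K"
    and between_g: "\<lbrakk>a \<in> K; x \<in> K; b \<in> K\<rbrakk> \<Longrightarrow> \<forall>\<^sub>F F in \<F>. between (g F a) (g F x) (g F b) \<longleftrightarrow> between a x b"
begin

lemma eventually_collinear:
  assumes "a \<in> K" "b \<in> K" "c \<in> K"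
  shows "\<forall>\<^sub>F F in \<F>. D3 (hat (g F a)) (hat (g F b)) (hat (g F c)) = 0 \<longleftrightarrow> D3 (hat a) (hat b) (hat c) = 0"
  using between_g[OF assms] between_g[OF assms(2,3,1)] between_g[OF assms(3,1,2)]
  by eventually_elim (simp add: D3_hat_eq_0_iff)

text \<open>The centroid is reached through the midpoint \<open>m\<close> of \<open>p1\<close> and
  \<open>p2\<close>, so two betweenness facts put \<open>g F u\<close> into the image triangle. Its
  barycentric weights are the scale factors of the frame; they are nonzero because \<open>u\<close>
  is on no side line of the triangle.\<close>

lemma eventually_frame:
  assumes p: "p0 \<in> K" "p1 \<in> K" "p2 \<in> K" and D: "D3 (hat p0) (hat p1) (hat p2) \<noteq> 0"
    and u: "hat u = (1/3) *\<^sub>R (hat p0 + hat p1 + hat p2)"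
  shows "\<forall>\<^sub>F F in \<F>. \<exists>A a0 a1 a2. det A \<noteq> 0 \<and> a0 > 0 \<and> a1 > 0 \<and> a2 > 0 \<and>
     A *v hat p0 = a0 *\<^sub>R hat (g F p0) \<and> A *v hat p1 = a1 *\<^sub>R hat (g F p1) \<and> A *v hat p2 = a2 *\<^sub>R hat (g F p2) \<and>
     A *v (hat p0 + hat p1 + hat p2) = hat (g F u)"
proof -
  define m where "m = midpoint p1 p2"
  have hm: "hat m = (1 - 1/2) *\<^sub>R hat p1 + (1/2) *\<^sub>R hat p2"
    by (simp add: m_def midpoint_def vec_eq_iff forall_3)
  have "between p1 m p2" unfolding between_iff_hat using hm by (intro exI[of _ "1/2"]) simp
  have "hat u = (1 - 2/3) *\<^sub>R hat p0 + (2/3) *\<^sub>R hat m"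
    unfolding u hm by (simp add: scaleR_add_right)
  then have "between p0 u m" unfolding between_iff_hat by (intro exI[of _ "2/3"]) simp
  have mK: "m \<in> K" using closed_segment_subset[OF p(2,3) convex_K] \<open>between p1 m p2\<close>
    unfolding between_def by blast
  have uK: "u \<in> K" using closed_segment_subset[OF p(1) mK convex_K] \<open>between p0 u m\<close>
    unfolding between_def by blast
  have Du: "D3 (hat u) (hat p1) (hat p2) \<noteq> 0" "D3 (hat p0) (hat u) (hat p2) \<noteq> 0" "D3 (hat p0) (hat p1) (hat u) \<noteq> 0"
    unfolding u using D by (simp_all add: D3_add)
  show ?thesis
    using between_g[OF p(2) mK p(3)] between_g[OF p(1) uK mK] eventually_collinear[OF p]
      eventually_collinear[OF uK p(2,3)] eventually_collinear[OF p(1) uK p(3)] eventually_collinear[OF p(1,2) uK]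
  proof eventually_elim
    case (elim F)
    let ?p0 = "hat (g F p0)" and ?p1 = "hat (g F p1)" and ?p2 = "hat (g F p2)"
    obtain s where s: "0 \<le> s" "s \<le> 1" "hat (g F m) = (1 - s) *\<^sub>R ?p1 + s *\<^sub>R ?p2"
      using elim(1) \<open>between p1 m p2\<close> between_iff_hat by blast
    obtain t where t: "0 \<le> t" "t \<le> 1" "hat (g F u) = (1 - t) *\<^sub>R ?p0 + t *\<^sub>R hat (g F m)"
      using elim(2) \<open>between p0 u m\<close> between_iff_hat by blast
    define a0 a1 a2 where "a0 = 1 - t" and "a1 = t * (1 - s)" and "a2 = t * s"
    have gu: "hat (g F u) = a0 *\<^sub>R ?p0 + a1 *\<^sub>R ?p1 + a2 *\<^sub>R ?p2"
      by (simp add: t(3) s(3) a0_def a1_def a2_def scaleR_add_right)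
    have D': "D3 ?p0 ?p1 ?p2 \<noteq> 0" using elim(3) D by simp
    have "a0 \<ge> 0" "a1 \<ge> 0" "a2 \<ge> 0" using s t by (simp_all add: a0_def a1_def a2_def)
    moreover have "a0 \<noteq> 0" "a1 \<noteq> 0" "a2 \<noteq> 0"
      using elim(4-6) Du by (auto simp: gu D3_add)
    ultimately have pos: "a0 > 0" "a1 > 0" "a2 > 0" by auto
    obtain A where A: "A *v hat p0 = a0 *\<^sub>R ?p0" "A *v hat p1 = a1 *\<^sub>R ?p1" "A *v hat p2 = a2 *\<^sub>R ?p2"
      using frame_matrix[OF D] by blast
    have "det A * D3 (hat p0) (hat p1) (hat p2) = a0 * a1 * a2 * D3 ?p0 ?p1 ?p2"
      by (simp add: D3_matrix[symmetric] A)
    then have "det A \<noteq> 0" using pos D' by auto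
    moreover have "A *v (hat p0 + hat p1 + hat p2) = hat (g F u)"
      by (simp add: matrix_vector_right_distrib A gu)
    ultimately show ?case using pos A by blast
  qed
qed

end

locale framed_embedding = asymptotic_embedding K K' \<F> g
  for K K' :: "(real^2) set" and \<F> :: "'i filter" and g :: "'i \<Rightarrow> real^2 \<Rightarrow> real^2" +
  fixes p0 p1 p2 :: "real^2" and T :: "'i \<Rightarrow> real^3^3" and a0 a1 a2 :: "'i \<Rightarrow> real" and u :: "real^2"
  assumes p_in_K: "p0 \<in> K" "p1 \<in> K" "p2 \<in> K"
    and det_frame: "D3 (hat p0) (hat p1) (hat p2) \<noteq> 0"
    and hat_u: "hat u = (1/3) *\<^sub>R (hat p0 + hat p1 + hat p2)"
    and frame: "\<forall>\<^sub>F F in \<F>. det (T F) \<noteq> 0 \<and> a0 F > 0 \<and> a1 F > 0 \<and> a2 F > 0 \<and>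
     T F *v hat p0 = a0 F *\<^sub>R hat (g F p0) \<and> T F *v hat p1 = a1 F *\<^sub>R hat (g F p1) \<and> T F *v hat p2 = a2 F *\<^sub>R hat (g F p2) \<and>
     T F *v (hat p0 + hat p1 + hat p2) = hat (g F u)"
begin

definition track :: "('i \<Rightarrow> real^3) \<Rightarrow> real^3 \<Rightarrow> real^2 \<Rightarrow> bool" where
  "track v w x \<longleftrightarrow> x \<in> K \<and> (\<exists>k. k \<noteq> 0 \<and> w = k *\<^sub>R hat x) \<and> (v \<longlongrightarrow> w) \<F> \<and>
     (\<forall>\<^sub>F F in \<F>. \<exists>s. s \<noteq> 0 \<and> T F *v v F = s *\<^sub>R hat (g F x))"

text \<open>The intersection point of two lines through tracked points is tracked, because the cross product
  gives its homogeneous coordinates as a continuous function of those of the four points.\<close>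

lemma track_intersection:
  assumes t: "track va a xa" "track vb b xb" "track va' a' xa'" "track vb' b' xb'"
    and c: "x \<in> K" "k \<noteq> 0" "c = k *\<^sub>R hat x"
    and D: "D3 a b c = 0" "D3 a' b' c = 0" "D3 a b a' \<noteq> 0" "D3 a' b' a \<noteq> 0"
  obtains l where "track (\<lambda>F. l *\<^sub>R cross3 (cross3 (va F) (vb F)) (cross3 (va' F) (vb' F))) c x"
    "c = l *\<^sub>R cross3 (cross3 a b) (cross3 a' b')"
proof -
  define N where "N a b a' b' = cross3 (cross3 a b) (cross3 a' b')" for a b a' b' :: "real^3"
  have N0: "N a b a' b' \<noteq> 0"
  proof
    assume "N a b a' b' = 0"
    moreover have "N a b a' b' = (D3 a b b') *\<^sub>R a' - (D3 a b a') *\<^sub>R b'"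
      by (simp add: N_def D3_expand vec_eq_iff forall_3 cross3_def algebra_simps)
    ultimately have "(D3 a b a') *\<^sub>R b' = (D3 a b b') *\<^sub>R a'" by simp
    from arg_cong[OF this, of "\<lambda>z. D3 a' z a"] have "D3 a b a' * D3 a' b' a = 0" by simp
    then show False using D(3,4) by simp
  qed
  obtain l where l: "c = l *\<^sub>R N a b a' b'"
    using cross3_parallel[of "cross3 a b" c "cross3 a' b'"] D(1,2) N0 by (auto simp: D3_def N_def)
  define v where "v F = l *\<^sub>R N (va F) (vb F) (va' F) (vb' F)" for F
  have lim: "(v \<longlongrightarrow> c) \<F>"
    unfolding v_def[abs_def] l N_def using t by (intro tendsto_intros) (auto simp: track_def)
  have l0: "l \<noteq> 0" using l c(2,3) hat_neq_0 by auto
  have vnz: "\<forall>\<^sub>F F in \<F>. v F \<noteq> 0"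
    using tendsto_imp_eventually_ne[OF lim] c by simp
  obtain ka kb ka' kb' where k: "ka \<noteq> 0" "a = ka *\<^sub>R hat xa" "kb \<noteq> 0" "b = kb *\<^sub>R hat xb"
     "ka' \<noteq> 0" "a' = ka' *\<^sub>R hat xa'" "kb' \<noteq> 0" "b' = kb' *\<^sub>R hat xb'"
    using t unfolding track_def by blast
  have col: "D3 (hat xa) (hat xb) (hat x) = 0" "D3 (hat xa') (hat xb') (hat x) = 0"
    using D(1,2) k c by auto
  have inK: "xa \<in> K" "xb \<in> K" "xa' \<in> K" "xb' \<in> K" using t by (auto simp: track_def)
  have "\<forall>\<^sub>F F in \<F>. \<exists>s. s \<noteq> 0 \<and> T F *v v F = s *\<^sub>R hat (g F x)"
    using t[unfolded track_def, THEN conjunct2, THEN conjunct2, THEN conjunct2] frame vnz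
      eventually_collinear[OF inK(1,2) c(1)] eventually_collinear[OF inK(3,4) c(1)]
  proof eventually_elim
    case (elim F)
    obtain sa sb sa' sb' where s: "sa \<noteq> 0" "T F *v va F = sa *\<^sub>R hat (g F xa)" "sb \<noteq> 0" "T F *v vb F = sb *\<^sub>R hat (g F xb)"
      "sa' \<noteq> 0" "T F *v va' F = sa' *\<^sub>R hat (g F xa')" "sb' \<noteq> 0" "T F *v vb' F = sb' *\<^sub>R hat (g F xb')"
      using elim(1-4) by blast
    have dT: "det (T F) \<noteq> 0" using elim(5) by simp
    \<comment> \<open>The preimage of \<open>g F x\<close> under \<open>T F\<close> lies on both
      pulled-back lines, so it is proportional to their intersection \<open>v F\<close>.\<close>
    then obtain w where w: "T F *v w = hat (g F x)"
      by (metis invertible_det_nz invertible_def matrix_vector_mul_assoc matrix_vector_mul_lid)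
    have "det (T F) * D3 (va F) (vb F) w = 0"
      using elim(7) col by (simp add: D3_matrix[symmetric] s w)
    then have 1: "D3 (va F) (vb F) w = 0" using dT by simp
    have "det (T F) * D3 (va' F) (vb' F) w = 0"
      using elim(8) col by (simp add: D3_matrix[symmetric] s w)
    then have 2: "D3 (va' F) (vb' F) w = 0" using dT by simp
    have nz: "N (va F) (vb F) (va' F) (vb' F) \<noteq> 0" using elim(6) by (auto simp: v_def)
    then obtain m where m: "w = m *\<^sub>R N (va F) (vb F) (va' F) (vb' F)"
      using cross3_parallel[of "cross3 (va F) (vb F)" w "cross3 (va' F) (vb' F)"] 1 2
      by (auto simp: D3_def N_def)
    have "w \<noteq> 0" using w by (auto dest: sym)
    then have m0: "m \<noteq> 0" using m by auto
    have "v F = (l / m) *\<^sub>R w" using m m0 by (simp add: v_def)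
    then have "T F *v v F = (l / m) *\<^sub>R hat (g F x)"
      by (simp add: matrix_vector_mult_scaleR w)
    then show ?case using l0 m0 by (intro exI[of _ "l / m"]) simp
  qed
  then have "track v c x" unfolding track_def using c lim by blast
  then show ?thesis using that[of l] l by (simp add: v_def[abs_def] N_def)
qed

text \<open>Projective coordinates \<open>c\<close> with respect to the frame \<open>p0, p1, p2\<close> with unit point \<open>u\<close>.\<close>

definition fr :: "real^3 \<Rightarrow> real^3" where
  "fr c = c $ 1 *\<^sub>R hat p0 + c $ 2 *\<^sub>R hat p1 + c $ 3 *\<^sub>R hat p2"

definition weight :: "real^3 \<Rightarrow> real" where "weight c = c $ 1 + c $ 2 + c $ 3"

definition pt :: "real^3 \<Rightarrow> real^2" where
  "pt c = (1 / weight c) *\<^sub>R (c $ 1 *\<^sub>R p0 + c $ 2 *\<^sub>R p1 + c $ 3 *\<^sub>R p2)"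

text \<open>The closed frame triangle, which lies in \<open>K\<close>. The auxiliary points of the
  constructions have to stay in it for \<open>g F\<close> to be controlled there.\<close>

definition nonneg :: "real^3 \<Rightarrow> bool" where
  "nonneg c \<longleftrightarrow> c $ 1 \<ge> 0 \<and> c $ 2 \<ge> 0 \<and> c $ 3 \<ge> 0 \<and> weight c > 0"

lemma fr_pt: "weight c \<noteq> 0 \<Longrightarrow> fr c = weight c *\<^sub>R hat (pt c)"
  by (simp add: fr_def pt_def vec_eq_iff forall_3 weight_def)

lemma pt_in_K:
  assumes "nonneg c"
  shows "pt c \<in> K"
proof -
  have w: "weight c > 0" using assms by (simp add: nonneg_def)
  have "(c$1 / weight c) *\<^sub>R p0 + (c$2 / weight c) *\<^sub>R p1 + (c$3 / weight c) *\<^sub>R p2 \<in> convex hull {p0, p1, p2}"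
    unfolding convex_hull_3 mem_Collect_eq
    by (intro exI[of _ "c$1 / weight c"] exI[of _ "c$2 / weight c"] exI[of _ "c$3 / weight c"])
      (use assms w in \<open>auto simp: nonneg_def weight_def simp flip: add_divide_distrib\<close>)
  moreover have "convex hull {p0, p1, p2} \<subseteq> K"
    using p_in_K convex_K by (intro hull_minimal) auto
  moreover have "pt c = (c$1 / weight c) *\<^sub>R p0 + (c$2 / weight c) *\<^sub>R p1 + (c$3 / weight c) *\<^sub>R p2"
    by (simp add: pt_def scaleR_add_right)
  ultimately show ?thesis by auto
qed

lemma D3_fr: "D3 (fr a) (fr b) (fr c) = D3 (hat p0) (hat p1) (hat p2) * D3 a b c"
proof -
  have "D3 (axis 1 1) (axis 2 1) (axis 3 (1::real)) \<noteq> 0" by (simp add: D3_expand axis_def)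
  then obtain M :: "real^3^3" where M: "M *v axis 1 1 = hat p0" "M *v axis 2 1 = hat p1" "M *v axis 3 1 = hat p2"
    using frame_matrix by blast
  have fr: "fr c = M *v c" for c
  proof -
    have "c = c $ 1 *\<^sub>R axis 1 1 + c $ 2 *\<^sub>R axis 2 1 + c $ 3 *\<^sub>R axis 3 1"
      by (simp add: vec_eq_iff forall_3 axis_def)
    then have "M *v c = M *v (c $ 1 *\<^sub>R axis 1 1 + c $ 2 *\<^sub>R axis 2 1 + c $ 3 *\<^sub>R axis 3 1)"
      by (rule arg_cong)
    then show ?thesis unfolding matrix_vector_right_distrib matrix_vector_mult_scaleR M by (simp add: fr_def)
  qed
  have "D3 (hat p0) (hat p1) (hat p2) = det M" using D3_matrix[of M "axis 1 1" "axis 2 1" "axis 3 1"]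
    by (simp add: M) (simp add: D3_expand axis_def)
  then show ?thesis by (simp add: fr D3_matrix)
qed

text \<open>A good point is one where \<open>g F\<close> eventually agrees with the projective map \<open>T F\<close>.\<close>

definition good :: "real^3 \<Rightarrow> bool" where
  "good c \<longleftrightarrow> nonneg c \<and> track (\<lambda>_. fr c) (fr c) (pt c)"

text \<open>Lines through constant vectors meet in a constant vector, so exact agreement is
  inherited and not merely agreement in the limit.\<close>

lemma good_intersection:
  assumes g: "good a" "good b" "good a'" "good b'" and c: "nonneg c"
    and D: "D3 a b c = 0" "D3 a' b' c = 0" "D3 a b a' \<noteq> 0" "D3 a' b' a \<noteq> 0"
  shows "good c"
proof -
  have w: "weight c \<noteq> 0" using c by (auto simp: nonneg_def)
  obtain l where l: "track (\<lambda>F. l *\<^sub>R cross3 (cross3 (fr a) (fr b)) (cross3 (fr a') (fr b'))) (fr c) (pt c)"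
    "fr c = l *\<^sub>R cross3 (cross3 (fr a) (fr b)) (cross3 (fr a') (fr b'))"
    by (rule track_intersection[OF _ _ _ _ pt_in_K[OF c] w fr_pt[OF w],
        of "\<lambda>_. fr a" "fr a" "pt a" "\<lambda>_. fr b" "fr b" "pt b" "\<lambda>_. fr a'" "fr a'" "pt a'" "\<lambda>_. fr b'" "fr b'" "pt b'"])
      (use g D det_frame in \<open>auto simp: good_def D3_fr\<close>)
  then show ?thesis using c by (simp add: good_def)
qed

end

section \<open>The rational net\<close>

lemma scaleR_eq_imp_eq: "k *\<^sub>R x = y \<Longrightarrow> k \<noteq> 0 \<Longrightarrow> x = (1 / k) *\<^sub>R y"
  for x y :: "'a::real_vector"
  by auto

context framed_embedding
begin

abbreviation vec3 :: "real \<Rightarrow> real \<Rightarrow> real \<Rightarrow> real^3" where "vec3 x y z \<equiv> vector [x, y, z]"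

lemma fr_add: "fr (a + b) = fr a + fr b" and fr_scale: "fr (k *\<^sub>R a) = k *\<^sub>R fr a"
  by (simp_all add: fr_def algebra_simps)

lemma T_fr:
  "\<forall>\<^sub>F F in \<F>. T F *v fr c = (c $ 1 * a0 F) *\<^sub>R hat (g F p0) + (c $ 2 * a1 F) *\<^sub>R hat (g F p1) + (c $ 3 * a2 F) *\<^sub>R hat (g F p2)"
  using frame by eventually_elim (simp add: fr_def matrix_vector_right_distrib matrix_vector_mult_scaleR)

lemma good_frame: "good (vec3 1 0 0)" "good (vec3 0 1 0)" "good (vec3 0 0 1)" "good (vec3 1 1 1)"
proof -
  have u: "pt (vec3 1 1 1) = u"
  proof -
    have "hat (pt (vec3 1 1 1)) = hat u"
      unfolding hat_u by (simp add: pt_def weight_def vec_eq_iff forall_3)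
    then show ?thesis by simp
  qed
  have 1: "good c" if "nonneg c" "\<forall>\<^sub>F F in \<F>. \<exists>s. s \<noteq> 0 \<and> T F *v fr c = s *\<^sub>R hat (g F (pt c))" for c
    using that fr_pt[of c] pt_in_K[of c] unfolding good_def track_def by (auto simp: nonneg_def)
  show "good (vec3 1 0 0)"
    by (rule 1) (use frame in \<open>auto simp: nonneg_def weight_def pt_def fr_def elim!: eventually_mono intro!: exI[of _ "a0 _"]\<close>)
  show "good (vec3 0 1 0)"
    by (rule 1) (use frame in \<open>auto simp: nonneg_def weight_def pt_def fr_def elim!: eventually_mono intro!: exI[of _ "a1 _"]\<close>)
  show "good (vec3 0 0 1)"
    by (rule 1) (use frame in \<open>auto simp: nonneg_def weight_def pt_def fr_def elim!: eventually_mono intro!: exI[of _ "a2 _"]\<close>)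
  show "good (vec3 1 1 1)"
    by (rule 1, unfold u) (use frame in \<open>auto simp: nonneg_def weight_def fr_def elim!: eventually_mono intro!: exI[of _ 1]\<close>)
qed

lemmas coord_simps = D3_expand nonneg_def weight_def

text \<open>Read \<open>vec3 1 s t\<close> as the affine point \<open>(s, t)\<close> with origin
  \<open>p0\<close> and the edge from \<open>p1\<close> to \<open>p2\<close> at infinity. Then
  \<open>vec3 0 1 1\<close> is the direction of the diagonal through the unit point.\<close>

lemma good_ideal: "good (vec3 0 1 1)"
  by (rule good_intersection[OF good_frame(1,4,2,3)]) (auto simp: coord_simps)

lemma good_unit: "good (vec3 1 1 0)" "good (vec3 1 0 1)"
  by (rule good_intersection[OF good_frame(3,4,1,2)] good_intersection[OF good_frame(2,4,1,3)],
      auto simp: coord_simps)+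

lemma good_project:
  assumes "good (vec3 1 s t)" "s > 0" "t > 0"
  shows "good (vec3 1 s 0)" "good (vec3 1 0 t)"
  by (rule good_intersection[OF assms(1) good_frame(3,1,2)] good_intersection[OF assms(1) good_frame(2,1,3)],
      use assms(2,3) in \<open>auto simp: coord_simps\<close>)+

text \<open>The diagonal point \<open>(t, t)\<close> carries a coordinate from one axis to the
  other.\<close>

lemma good_swap:
  assumes "t > 0"
  shows "good (vec3 1 t 0) \<longleftrightarrow> good (vec3 1 0 t)"
proof
  assume A: "good (vec3 1 t 0)"
  have "good (vec3 1 t t)"
    by (rule good_intersection[OF A good_frame(3,1) good_ideal]) (use assms in \<open>auto simp: coord_simps\<close>)
  then show "good (vec3 1 0 t)" using good_project assms by blast
next
  assume A: "good (vec3 1 0 t)"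
  have "good (vec3 1 t t)"
    by (rule good_intersection[OF A good_frame(2,1) good_ideal]) (use assms in \<open>auto simp: coord_simps\<close>)
  then show "good (vec3 1 t 0)" using good_project assms by blast
qed

text \<open>Addition after von Staudt: the parallel to the diagonal through \<open>(0, b)\<close>
  has height \<open>b + t\<close> above \<open>(t, 0)\<close>.\<close>

lemma good_sum:
  assumes "good (vec3 1 0 b)" "good (vec3 1 0 t)" "b > 0" "t > 0"
  shows "good (vec3 1 0 (b + t))"
proof -
  have A: "good (vec3 1 t 0)" using assms good_swap by blast
  have "good (vec3 1 t (b + t))"
    by (rule good_intersection[OF assms(1) good_ideal A good_frame(3)])
      (use assms in \<open>auto simp: coord_simps\<close>)
  then show ?thesis using good_project assms by force
qed

text \<open>Similar triangles: the line from the origin to \<open>(a, q * a)\<close> also passes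
  through \<open>(1, q)\<close>.\<close>

lemma good_quotient:
  assumes "good (vec3 1 0 a)" "good (vec3 1 0 (q * a))" "a > 0" "q > 0"
  shows "good (vec3 1 0 q)"
proof -
  have A: "good (vec3 1 a 0)" using assms good_swap by blast
  have "good (vec3 1 a (q * a))"
    by (rule good_intersection[OF A good_frame(3) assms(2) good_frame(2)])
      (use assms in \<open>auto simp: coord_simps add_pos_pos\<close>)
  \<comment> \<open>For \<open>a = 1\<close> the point \<open>(a, q * a)\<close> already lies on the
    second line of the last intersection, which \<open>good_intersection\<close> forbids; the ideal
    point of the same line does not.\<close>
  then have B: "good (vec3 0 a (q * a))"
    by (rule good_intersection[OF _ good_frame(1,2,3)]) (use assms in \<open>auto simp: coord_simps add_pos_pos\<close>)
  have "good (vec3 1 1 q)"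
    by (rule good_intersection[OF B good_frame(1) good_unit(1) good_frame(3)])
      (use assms in \<open>auto simp: coord_simps\<close>)
  then show ?thesis using good_project assms by force
qed

text \<open>Repeated addition of the unit gives the positive integers, and \<open>r\<close> is the
  quotient of two of them.\<close>

lemma good_rational:
  assumes "r \<in> \<rat>" "r > 0"
  shows "good (vec3 1 r 0)" "good (vec3 1 0 r)"
proof -
  have nat: "good (vec3 1 0 (real (Suc n)))" for n
  proof (induction n)
    case 0 then show ?case using good_unit by simp
  next
    case (Suc n) then show ?case using good_sum[OF Suc good_unit(2)] by (simp add: add_ac)
  qed
  obtain m n :: nat where mn: "n \<noteq> 0" "\<bar>r\<bar> = real m / real n"
    using Rats_abs_nat_div_natE[OF assms(1)] by metis
  have "m \<noteq> 0"
  proof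
    assume "m = 0"
    then show False using mn assms(2) by simp
  qed
  then obtain m' n' where "m = Suc m'" "n = Suc n'" using mn(1) not0_implies_Suc by metis
  then have "r * real (Suc n') = real (Suc m')" using mn assms(2) by (simp add: field_simps)
  then show "good (vec3 1 0 r)"
    using good_quotient[OF nat[of n'], of r] nat[of m'] assms(2) by simp
  then show "good (vec3 1 r 0)" using good_swap assms(2) by blast
qed

section \<open>From rational edge points to all points of \<open>K\<close>\<close>

lemma between_pt:
  assumes "nonneg a" "nonneg b" "\<alpha> \<ge> 0" "\<beta> \<ge> 0" "\<alpha> + \<beta> > 0"
  shows "between (pt a) (pt (\<alpha> *\<^sub>R a + \<beta> *\<^sub>R b)) (pt b)" "nonneg (\<alpha> *\<^sub>R a + \<beta> *\<^sub>R b)"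
proof -
  let ?c = "\<alpha> *\<^sub>R a + \<beta> *\<^sub>R b"
  have w: "weight ?c = \<alpha> * weight a + \<beta> * weight b" by (simp add: weight_def algebra_simps)
  have pos: "weight a > 0" "weight b > 0" using assms by (auto simp: nonneg_def)
  have "\<alpha> * weight a \<ge> 0" "\<beta> * weight b \<ge> 0" using pos assms by simp_all
  moreover have "\<alpha> * weight a > 0 \<or> \<beta> * weight b > 0"
    using assms(3-5) pos by (cases "\<alpha> > 0") auto
  ultimately have wc: "weight ?c > 0" unfolding w by linarith
  then show nn: "nonneg ?c" using assms by (simp add: nonneg_def)
  define \<theta> where "\<theta> = \<beta> * weight b / weight ?c"
  have \<theta>: "0 \<le> \<theta>" "\<theta> \<le> 1" "1 - \<theta> = \<alpha> * weight a / weight ?c"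
    using \<open>\<alpha> * weight a \<ge> 0\<close> \<open>\<beta> * weight b \<ge> 0\<close> wc unfolding \<theta>_def w by (simp_all add: field_simps)
  have "weight ?c *\<^sub>R hat (pt ?c) = fr ?c" using wc by (simp add: fr_pt)
  also have "\<dots> = (\<alpha> * weight a) *\<^sub>R hat (pt a) + (\<beta> * weight b) *\<^sub>R hat (pt b)"
    using pos by (simp add: fr_add fr_scale fr_pt)
  finally have "hat (pt ?c) = (1 / weight ?c) *\<^sub>R ((\<alpha> * weight a) *\<^sub>R hat (pt a) + (\<beta> * weight b) *\<^sub>R hat (pt b))"
    by (rule scaleR_eq_imp_eq) (use wc in simp)
  also have "\<dots> = (1 - \<theta>) *\<^sub>R hat (pt a) + \<theta> *\<^sub>R hat (pt b)"
    by (simp add: scaleR_add_right \<theta>(3)) (simp add: \<theta>_def)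
  finally show "between (pt a) (pt ?c) (pt b)" unfolding between_iff_hat using \<theta> by blast
qed

text \<open>The factor is the third coordinate of the image, a nonnegative combination of
  \<open>a0 F\<close>, \<open>a1 F\<close>, \<open>a2 F\<close>. Positive factors allow convex
  weights to be pulled back through \<open>T F\<close>.\<close>

lemma good_weight_pos:
  assumes "good c"
  shows "\<forall>\<^sub>F F in \<F>. \<exists>s>0. T F *v fr c = s *\<^sub>R hat (g F (pt c))"
proof -
  have c: "nonneg c" "\<forall>\<^sub>F F in \<F>. \<exists>s. s \<noteq> 0 \<and> T F *v fr c = s *\<^sub>R hat (g F (pt c))"
    using assms by (auto simp: good_def track_def)
  show ?thesis using c(2) T_fr[of c] frame
  proof eventually_elim
    case (elim F)
    obtain s where s: "s \<noteq> 0" "T F *v fr c = s *\<^sub>R hat (g F (pt c))" using elim(1) by blast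
    have "s = (T F *v fr c) $ 3" by (simp add: s(2))
    also have "\<dots> = c $ 1 * a0 F + c $ 2 * a1 F + c $ 3 * a2 F" unfolding elim(2) by simp
    also have "\<dots> \<ge> 0" using elim(3) c(1) by (simp add: nonneg_def)
    finally show ?case using s by (intro exI[of _ s]) simp
  qed
qed

text \<open>A real point of an edge is squeezed between rational ones, on which \<open>T F\<close> agrees with \<open>g F\<close>.\<close>

lemma track_edge:
  assumes e: "e \<in> {vec3 0 1 0, vec3 0 0 1}" and t: "t > 0"
  obtains v where "track v (fr (vec3 1 0 0 + t *\<^sub>R e)) (pt (vec3 1 0 0 + t *\<^sub>R e))"
proof -
  define E where "E \<rho> = vec3 1 0 0 + \<rho> *\<^sub>R e" for \<rho>
  have nnE: "nonneg (E \<rho>)" if "\<rho> \<ge> 0" for \<rho>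
    using e that by (auto simp: E_def nonneg_def weight_def)
  have goodE: "good (E r)" if "r \<in> \<rat>" "r > 0" for r
  proof -
    have "E r = vec3 1 r 0 \<or> E r = vec3 1 0 r" using e by (auto simp: E_def vec_eq_iff forall_3)
    then show ?thesis using good_rational[OF that] by auto
  qed
  \<comment> \<open>\<open>\<rho>\<close> is the edge parameter whose image under \<open>T F\<close>
    is \<open>g F (pt (E t))\<close>; eventually it exists and is unique.\<close>
  define P where "P F \<rho> \<longleftrightarrow> (\<exists>s. s \<noteq> 0 \<and> T F *v fr (E \<rho>) = s *\<^sub>R hat (g F (pt (E t))))" for F \<rho>
  have D_E: "\<exists>z. D3 (E \<rho>) (E \<rho>') z = \<rho>' - \<rho>" for \<rho> \<rho>'
    using e by (auto simp: E_def D3_expand intro: exI[of _ "vec3 0 0 1"] exI[of _ "vec3 0 (-1) 0"])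
  have uniq: "\<forall>\<^sub>F F in \<F>. \<forall>\<rho> \<rho>'. P F \<rho> \<longrightarrow> P F \<rho>' \<longrightarrow> \<rho> = \<rho>'"
    using frame
  proof eventually_elim
    case (elim F)
    show ?case
    proof (intro allI impI)
      fix \<rho> \<rho>' assume "P F \<rho>" "P F \<rho>'"
      then obtain s s' where s: "T F *v fr (E \<rho>) = s *\<^sub>R hat (g F (pt (E t)))"
        "T F *v fr (E \<rho>') = s' *\<^sub>R hat (g F (pt (E t)))"
        unfolding P_def by blast
      obtain z where z: "D3 (E \<rho>) (E \<rho>') z = \<rho>' - \<rho>" using D_E by blast
      have "det (T F) * D3 (fr (E \<rho>)) (fr (E \<rho>')) (fr z) = 0" by (simp add: D3_matrix[symmetric] s)
      then show "\<rho> = \<rho>'" using elim det_frame by (simp add: D3_fr z)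
    qed
  qed
  have squeeze: "\<forall>\<^sub>F F in \<F>. \<exists>\<rho>. P F \<rho> \<and> r \<le> \<rho> \<and> \<rho> \<le> r'" 
    if r: "r \<in> \<rat>" "r' \<in> \<rat>" "0 < r" "r < t" "t < r'" for r r'
  proof -
    define \<alpha> where "\<alpha> = (r' - t) / (r' - r)"
    have \<alpha>: "0 < \<alpha>" "\<alpha> < 1" "\<alpha> * r + (1 - \<alpha>) * r' = t"
    proof -
      show "0 < \<alpha>" "\<alpha> < 1" using r by (simp_all add: \<alpha>_def field_simps)
      have "\<alpha> * (r' - r) = r' - t" using r by (simp add: \<alpha>_def)
      then show "\<alpha> * r + (1 - \<alpha>) * r' = t" by (simp add: algebra_simps)
    qed
    have eq: "E t = \<alpha> *\<^sub>R E r + (1 - \<alpha>) *\<^sub>R E r'"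
      unfolding E_def \<alpha>(3)[symmetric] by (simp add: algebra_simps)
    have btw: "between (pt (E r)) (pt (E t)) (pt (E r'))"
      unfolding eq using between_pt(1)[of "E r" "E r'" \<alpha> "1 - \<alpha>"] nnE r \<alpha> by simp
    have gr: "good (E r)" "good (E r')" using goodE r by auto
    have inK: "pt (E r) \<in> K" "pt (E t) \<in> K" "pt (E r') \<in> K" using pt_in_K nnE r by auto
    show ?thesis using good_weight_pos[OF gr(1)] good_weight_pos[OF gr(2)] between_g[OF inK] 
    proof eventually_elim
      case (elim F)
      obtain s s' where s: "s > 0" "T F *v fr (E r) = s *\<^sub>R hat (g F (pt (E r)))"
         "s' > 0" "T F *v fr (E r') = s' *\<^sub>R hat (g F (pt (E r')))"
        using elim(1,2) by blast
      obtain \<theta> where \<theta>: "0 \<le> \<theta>" "\<theta> \<le> 1" "hat (g F (pt (E t))) = (1 - \<theta>) *\<^sub>R hat (g F (pt (E r))) + \<theta> *\<^sub>R hat (g F (pt (E r')))"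
        using elim(3) btw unfolding between_iff_hat by blast
      \<comment> \<open>Dividing by the scale factors makes \<open>T F\<close> hit
        \<open>hat (g F (pt (E t)))\<close> exactly. As \<open>s\<close> and \<open>s'\<close> are
        positive, the weighted mean \<open>\<rho>\<close> below stays between \<open>r\<close> and
        \<open>r'\<close>.\<close>
      define A where "A = (1 - \<theta>) / s"
      define B where "B = \<theta> / s'"
      have AB: "A \<ge> 0" "B \<ge> 0" using \<theta> s by (simp_all add: A_def B_def)
      have "A + B > 0"
      proof (cases "\<theta> = 0")
        case True then show ?thesis using s by (simp add: A_def B_def)
      next
        case False
        then have "B > 0" using \<theta> s by (simp add: B_def)
        then show ?thesis using AB by simp
      qed
      have T: "T F *v (A *\<^sub>R fr (E r) + B *\<^sub>R fr (E r')) = hat (g F (pt (E t)))"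
        using s by (simp add: matrix_vector_right_distrib matrix_vector_mult_scaleR A_def B_def \<theta>(3))
      define \<rho> where "\<rho> = (A * r + B * r') / (A + B)"
      have \<rho>: "(A + B) * \<rho> = A * r + B * r'" using \<open>A + B > 0\<close> by (simp add: \<rho>_def)
      have "A *\<^sub>R E r + B *\<^sub>R E r' = (A + B) *\<^sub>R vec3 1 0 0 + (A * r + B * r') *\<^sub>R e"
        by (simp add: E_def algebra_simps)
      also have "\<dots> = (A + B) *\<^sub>R E \<rho>"
        unfolding \<rho>[symmetric] by (simp add: E_def scaleR_add_right)
      finally have "A *\<^sub>R fr (E r) + B *\<^sub>R fr (E r') = (A + B) *\<^sub>R fr (E \<rho>)"
        by (metis fr_add fr_scale)
      then have "(A + B) *\<^sub>R (T F *v fr (E \<rho>)) = hat (g F (pt (E t)))"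
        using T by (simp add: matrix_vector_mult_scaleR)
      then have "T F *v fr (E \<rho>) = (1 / (A + B)) *\<^sub>R hat (g F (pt (E t)))"
        by (rule scaleR_eq_imp_eq) (use \<open>A + B > 0\<close> in simp)
      then have "P F \<rho>" unfolding P_def using \<open>A + B > 0\<close> by (intro exI[of _ "1 / (A + B)"]) simp
      moreover have "(A + B) * r \<le> (A + B) * \<rho>" "(A + B) * \<rho> \<le> (A + B) * r'"
        unfolding \<rho> using AB r by (simp_all add: algebra_simps mult_left_mono)
      ultimately show ?case using \<open>A + B > 0\<close> by (intro exI[of _ \<rho>]) simp
    qed
  qed
  define \<rho> where "\<rho> F = (SOME \<rho>. P F \<rho>)" for F
  have bounds: "\<forall>\<^sub>F F in \<F>. P F (\<rho> F) \<and> r \<le> \<rho> F \<and> \<rho> F \<le> r'"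
    if "r \<in> \<rat>" "r' \<in> \<rat>" "0 < r" "r < t" "t < r'" for r r'
    using squeeze[OF that] uniq
  proof eventually_elim
    case (elim F)
    then obtain x where x: "P F x" "r \<le> x" "x \<le> r'" by blast
    then have "P F (\<rho> F)" unfolding \<rho>_def by (metis someI)
    then have "\<rho> F = x" using elim(2) x by blast
    then show ?case using x by simp
  qed
  obtain r0 where r0: "r0 \<in> \<rat>" "0 < r0" "r0 < t" using Rats_dense_in_real[OF t] by blast
  obtain r0' where r0': "r0' \<in> \<rat>" "t < r0'" using Rats_dense_in_real[of t "t + 1"] by auto
  have "(\<rho> \<longlongrightarrow> t) \<F>"
  proof (rule order_tendstoI)
    fix a assume "a < t"
    then obtain r where "r \<in> \<rat>" "max 0 a < r" "r < t" using Rats_dense_in_real[of "max 0 a" t] t by auto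
    then show "\<forall>\<^sub>F F in \<F>. a < \<rho> F"
      using bounds[of r r0'] r0' by (auto elim!: eventually_mono)
  next
    fix a assume "t < a"
    then obtain r where "r \<in> \<rat>" "t < r" "r < a" using Rats_dense_in_real by blast
    then show "\<forall>\<^sub>F F in \<F>. \<rho> F < a"
      using bounds[of r0 r] r0 by (auto elim!: eventually_mono)
  qed
  then have "((\<lambda>F. fr (vec3 1 0 0) + \<rho> F *\<^sub>R fr e) \<longlongrightarrow> fr (vec3 1 0 0) + t *\<^sub>R fr e) \<F>"
    by (intro tendsto_intros)
  then have lim: "((\<lambda>F. fr (E (\<rho> F))) \<longlongrightarrow> fr (E t)) \<F>" by (simp add: E_def fr_add fr_scale)
  have "weight (E t) \<noteq> 0" using nnE[of t] t by (auto simp: nonneg_def)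
  then have "\<exists>k. k \<noteq> 0 \<and> fr (E t) = k *\<^sub>R hat (pt (E t))" using fr_pt by blast
  moreover have "\<forall>\<^sub>F F in \<F>. \<exists>s. s \<noteq> 0 \<and> T F *v fr (E (\<rho> F)) = s *\<^sub>R hat (g F (pt (E t)))"
    using bounds[OF r0(1) r0'(1) r0(2,3) r0'(2)] by eventually_elim (simp add: P_def)
  ultimately have "track (\<lambda>F. fr (E (\<rho> F))) (fr (E t)) (pt (E t))"
    unfolding track_def using lim pt_in_K nnE t by auto
  then show ?thesis using that unfolding E_def by blast
qed

text \<open>The point is the intersection of two lines, from \<open>p2\<close> and from
  \<open>p1\<close>, through tracked points of the opposite edges.\<close>

lemma track_interior:
  assumes c: "c $ 1 > 0" "c $ 2 > 0" "c $ 3 > 0"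
  obtains v where "track v (fr c) (pt c)"
proof -
  define s t where "s = c $ 2 / c $ 1" and "t = c $ 3 / c $ 1"
  have "s > 0" "t > 0" using c by (simp_all add: s_def t_def)
  have eqs: "vec3 1 0 0 + s *\<^sub>R vec3 0 1 0 = vec3 1 s 0" "vec3 1 0 0 + t *\<^sub>R vec3 0 0 1 = vec3 1 0 t"
    by (simp_all add: vec_eq_iff forall_3)
  obtain v where v: "track v (fr (vec3 1 s 0)) (pt (vec3 1 s 0))"
    using track_edge[of "vec3 0 1 0" s] \<open>s > 0\<close> unfolding eqs by blast
  obtain v' where v': "track v' (fr (vec3 1 0 t)) (pt (vec3 1 0 t))"
    using track_edge[of "vec3 0 0 1" t] \<open>t > 0\<close> unfolding eqs by blast
  have f: "track (\<lambda>_. fr (vec3 0 0 1)) (fr (vec3 0 0 1)) (pt (vec3 0 0 1))"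
    "track (\<lambda>_. fr (vec3 0 1 0)) (fr (vec3 0 1 0)) (pt (vec3 0 1 0))"
    using good_frame by (auto simp: good_def)
  have nn: "nonneg c" using c by (simp add: nonneg_def weight_def)
  have w: "weight c \<noteq> 0" using nn by (auto simp: nonneg_def)
  have D: "D3 (vec3 1 s 0) (vec3 0 0 1) c = 0" "D3 (vec3 1 0 t) (vec3 0 1 0) c = 0"
    "D3 (vec3 1 s 0) (vec3 0 0 1) (vec3 1 0 t) \<noteq> 0" "D3 (vec3 1 0 t) (vec3 0 1 0) (vec3 1 s 0) \<noteq> 0"
    using c by (simp_all add: D3_expand s_def t_def)
  show ?thesis
    by (rule track_intersection[OF v f(1) v' f(2) pt_in_K[OF nn] w fr_pt[OF w]])
      (use that D det_frame in \<open>auto simp: D3_fr\<close>)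
qed

text \<open>\<open>x\<close> may lie outside the triangle. It is still the intersection of two lines
  that each contain two tracked points of the triangle.\<close>

lemma track_all:
  assumes x: "x \<in> K"
  obtains v where "track v (hat x) x"
proof -
  define c where "c = (1 / D3 (hat p0) (hat p1) (hat p2)) *\<^sub>R
    vec3 (D3 (hat x) (hat p1) (hat p2)) (D3 (hat p0) (hat x) (hat p2)) (D3 (hat p0) (hat p1) (hat x))"
  have frc: "fr c = hat x"
  proof -
    have "D3 (hat p0) (hat p1) (hat p2) *\<^sub>R hat x = D3 (hat x) (hat p1) (hat p2) *\<^sub>R hat p0 +
        D3 (hat p0) (hat x) (hat p2) *\<^sub>R hat p1 + D3 (hat p0) (hat p1) (hat x) *\<^sub>R hat p2"
      by (simp add: D3_expand vec_eq_iff forall_3 algebra_simps)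
    moreover have "fr c = (1 / D3 (hat p0) (hat p1) (hat p2)) *\<^sub>R (D3 (hat x) (hat p1) (hat p2) *\<^sub>R hat p0 +
        D3 (hat p0) (hat x) (hat p2) *\<^sub>R hat p1 + D3 (hat p0) (hat p1) (hat x) *\<^sub>R hat p2)"
      by (simp add: c_def fr_def scaleR_add_right)
    ultimately show ?thesis using scaleR_eq_imp_eq[OF _ det_frame, of "hat x"] by simp
  qed
  \<comment> \<open>Both determinants vanish only if \<open>c\<close> is proportional to the unit
    point, so that \<open>x\<close> is the centroid. Otherwise one of the two test vectors lies off
    the line joining the centroid to \<open>x\<close>.\<close>
  show ?thesis
  proof (cases "D3 (vec3 1 1 1) c (vec3 1 2 1) = 0 \<and> D3 (vec3 1 1 1) c (vec3 1 1 2) = 0")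
    case True
    then have "c $ 1 = c $ 2" "c $ 1 = c $ 3" by (auto simp: D3_expand)
    moreover have "weight c = 1"
      using arg_cong[OF frc, of "\<lambda>v. v $ 3"] by (simp add: fr_def weight_def)
    ultimately have c13: "c $ 1 = 1/3" "c $ 2 = 1/3" "c $ 3 = 1/3" by (auto simp: weight_def)
    obtain v where "track v (fr c) (pt c)" using track_interior[of c] c13 by auto
    moreover have "pt c = x" using fr_pt[of c] frc \<open>weight c = 1\<close> by simp
    ultimately show ?thesis using that frc by simp
  next
    case False
    then obtain w where w: "w $ 1 > 0" "w $ 2 > 0" "w $ 3 > 0" "D3 (vec3 1 1 1) c w \<noteq> 0"
    proof (cases "D3 (vec3 1 1 1) c (vec3 1 2 1) = 0")
      case True
      then show ?thesis using False that[of "vec3 1 1 2"] by simp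
    next
      case False
      then show ?thesis using that[of "vec3 1 2 1"] by simp
    qed
    obtain \<epsilon> where \<epsilon>: "\<epsilon> > 0" "\<And>i. 1 + \<epsilon> * c $ i > 0" "\<And>i. w $ i + \<epsilon> * c $ i > 0"
    proof -
      \<comment> \<open>\<open>\<delta>\<close> bounds the coordinates of both base points from
        below and \<open>m\<close> exceeds each coordinate of \<open>c\<close> in absolute value, so
        a shift by \<open>\<delta> / m\<close> times \<open>c\<close> keeps them positive.\<close>
      define \<delta> where "\<delta> = min (min 1 (w $ 1)) (min (w $ 2) (w $ 3))"
      define m where "m = 1 + \<bar>c $ 1\<bar> + \<bar>c $ 2\<bar> + \<bar>c $ 3\<bar>"
      have \<delta>: "\<delta> > 0" "\<delta> \<le> 1" "\<And>i. \<delta> \<le> w $ i" using w by (auto simp: \<delta>_def split: if_splits) (metis exhaust_3 min.coboundedI1 min.coboundedI2 order_refl)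
      have m: "m > 0" "\<And>i. - m < c $ i" 
      proof -
        show "m > 0" by (simp add: m_def)
        have "\<forall>i. - m < c $ i" unfolding forall_3 m_def by linarith
        then show "- m < c $ i" for i by blast
      qed
      have "- \<delta> < \<delta> / m * c $ i" for i
        using mult_strict_left_mono[OF m(2)[of i] \<delta>(1)] m(1) by (simp add: field_simps)
      then show thesis using that[of "\<delta> / m"] \<delta> m(1) by (smt (verit) divide_pos_pos)
    qed
    obtain v1 where v1: "track v1 (fr (vec3 1 1 1)) (pt (vec3 1 1 1))" using good_frame by (auto simp: good_def)
    obtain v2 where v2: "track v2 (fr (vec3 1 1 1 + \<epsilon> *\<^sub>R c)) (pt (vec3 1 1 1 + \<epsilon> *\<^sub>R c))"
      using track_interior[of "vec3 1 1 1 + \<epsilon> *\<^sub>R c"] \<epsilon>(2) by auto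
    obtain v3 where v3: "track v3 (fr w) (pt w)" using track_interior w by blast
    obtain v4 where v4: "track v4 (fr (w + \<epsilon> *\<^sub>R c)) (pt (w + \<epsilon> *\<^sub>R c))"
      using track_interior[of "w + \<epsilon> *\<^sub>R c"] \<epsilon>(3) by auto
    have "D3 w c (vec3 1 1 1) \<noteq> 0" using w(4) by (simp add: D3_expand algebra_simps)
    then have D: "D3 (vec3 1 1 1) (vec3 1 1 1 + \<epsilon> *\<^sub>R c) c = 0" "D3 w (w + \<epsilon> *\<^sub>R c) c = 0"
      "D3 (vec3 1 1 1) (vec3 1 1 1 + \<epsilon> *\<^sub>R c) w \<noteq> 0" "D3 w (w + \<epsilon> *\<^sub>R c) (vec3 1 1 1) \<noteq> 0"
      using w(4) \<epsilon>(1) by (simp_all add: D3_add)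
    obtain l where "track (\<lambda>F. l *\<^sub>R cross3 (cross3 (v1 F) (v2 F)) (cross3 (v3 F) (v4 F))) (fr c) x"
    proof (rule track_intersection[OF v1 v2 v3 v4 x])
      show "1 \<noteq> (0::real)" "fr c = 1 *\<^sub>R hat x" using frc by simp_all
    qed (simp_all only: D3_fr D mult_eq_0_iff det_frame, simp_all)
    then show ?thesis using that unfolding frc by blast
  qed
qed

end

section \<open>Limits\<close>

text \<open>Replaces the choice of a subsequence, because the finite subsets of an uncountable set
  have no countable cofinal family. \<open>\<G>\<close> refines \<open>\<F>\<close> by the preimages
  of the neighbourhoods of a cluster point.\<close>

lemma compact_subfilter:
  assumes "compact U" "\<F> \<noteq> bot" "\<forall>\<^sub>F F in \<F>. f F \<in> U"
  obtains x \<G> where "x \<in> U" "\<G> \<le> \<F>" "\<G> \<noteq> bot" "(f \<longlongrightarrow> x) \<G>"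
proof -
  have "filtermap f \<F> \<noteq> bot" "\<forall>\<^sub>F y in filtermap f \<F>. y \<in> U"
    using assms by (simp_all add: filtermap_bot_iff eventually_filtermap)
  then obtain x where x: "x \<in> U" "inf (nhds x) (filtermap f \<F>) \<noteq> bot"
    using assms(1) unfolding compact_filter by blast
  define \<G> where "\<G> = inf \<F> (filtercomap f (nhds x))"
  have "\<G> \<noteq> bot"
  proof
    assume "\<G> = bot"
    then have "eventually (\<lambda>_. False) \<G>" by simp
    then obtain P R where P: "eventually P \<F>" "eventually R (nhds x)" "\<And>F. P F \<Longrightarrow> R (f F) \<Longrightarrow> False"
      unfolding \<G>_def eventually_inf eventually_filtercomap by blast
    have "\<forall>\<^sub>F y in filtermap f \<F>. \<not> R y"
      unfolding eventually_filtermap using P(1) by eventually_elim (use P(3) in blast)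
    with P(2) have "eventually (\<lambda>_. False) (inf (nhds x) (filtermap f \<F>))"
      unfolding eventually_inf by blast
    then show False using x(2) by (simp add: trivial_limit_def)
  qed
  moreover have "(f \<longlongrightarrow> x) \<G>"
    unfolding \<G>_def by (rule filterlim_mono[OF filterlim_filtercomap]) auto
  ultimately show ?thesis using that[of x \<G>] x(1) by (simp add: \<G>_def)
qed

lemma tendsto_matrix_vector_mult:
  fixes A :: "'i \<Rightarrow> real^'n^'m"
  assumes "(A \<longlongrightarrow> B) \<F>" "(v \<longlongrightarrow> w) \<F>"
  shows "((\<lambda>F. A F *v v F) \<longlongrightarrow> B *v w) \<F>"
  unfolding matrix_vector_mult_def
  by (rule vec_tendstoI) (auto intro!: tendsto_intros tendsto_vec_nth assms)

text \<open>Each row of \<open>A\<close> is a linear form that vanishes at infinitely many boundary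
  points, so it is zero.\<close>

lemma infinite_kernel_frontier:
  fixes A :: "real^3^3"
  assumes "convex_body K" "strictly_convex K" "infinite {x \<in> frontier K. A *v hat x = 0}"
  shows "A = 0"
proof -
  have "A $ k = 0" for k
  proof (rule ccontr)
    assume "A $ k \<noteq> 0"
    then have "finite {x \<in> frontier K. A $ k \<bullet> hat x = 0}"
      using finite_frontier_line assms by blast
    moreover have "{x \<in> frontier K. A *v hat x = 0} \<subseteq> {x \<in> frontier K. A $ k \<bullet> hat x = 0}"
      by (auto simp: matrix_vector_mul_component[symmetric])
    ultimately show False using assms(3) finite_subset by blast
  qed
  then show ?thesis by (simp add: vec_eq_iff)
qed

text \<open>By invariance of domain the image of the interior is open. As the boundary goes to the
  boundary, it is also the trace on \<open>interior K'\<close> of the compact image of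
  \<open>K\<close>, hence clopen in a connected set.\<close>

lemma surj_of_frontier:
  fixes f :: "real^2 \<Rightarrow> real^2"
  assumes K: "convex_body K" and K': "convex_body K'"
    and f: "continuous_on K f" "inj_on f K" "f ` K \<subseteq> K'" "f ` frontier K \<subseteq> frontier K'"
  shows "f ` K = K'"
proof -
  have KK: "compact K" "interior K \<noteq> {}" and KK': "convex K'" "closed K'" "interior K' \<noteq> {}"
    using K K' by (auto simp: convex_body_def compact_imp_closed)
  have Kun: "K = interior K \<union> frontier K"
    using compact_imp_closed[OF KK(1)] interior_subset by (auto simp: frontier_def)
  have op: "open (f ` interior K)"
    using f(1,2) interior_subset by (intro invariance_of_domain) (auto intro: continuous_on_subset inj_on_subset)
  have "f ` interior K \<subseteq> K'" using f(3) interior_subset by blast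
  then have sub: "f ` interior K \<subseteq> interior K'" using op by (rule interior_maximal)
  have "f ` interior K = f ` K \<inter> interior K'"
  proof
    show "f ` K \<inter> interior K' \<subseteq> f ` interior K"
    proof
      fix y assume "y \<in> f ` K \<inter> interior K'"
      then obtain x where x: "x \<in> K" "y = f x" "y \<in> interior K'" by blast
      have "x \<notin> frontier K" using f(4) x by (auto simp: frontier_def)
      then show "y \<in> f ` interior K" using x Kun by auto
    qed
  qed (use sub interior_subset in blast)
  moreover have "closed (f ` K)" using compact_continuous_image[OF f(1) KK(1)] compact_imp_closed by blast
  ultimately have "closedin (top_of_set (interior K')) (f ` interior K)"
    by (metis closedin_closed_Int inf_commute)
  moreover have "openin (top_of_set (interior K')) (f ` interior K)"
    using op sub by (simp add: open_subset)
  moreover have "connected (interior K')" using KK'(1) convex_interior convex_connected by blast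
  ultimately have "f ` interior K = interior K'"
    using KK(2) unfolding connected_clopen by blast
  then have "interior K' \<subseteq> f ` K" using interior_subset by blast
  then have "closure (interior K') \<subseteq> f ` K"
    using \<open>closed (f ` K)\<close> by (simp add: closure_minimal)
  moreover have "closure (interior K') = K'"
    using KK' convex_closure_interior closure_closed by metis
  ultimately show ?thesis using f(3) by blast
qed

section \<open>Projective equivalence\<close>

lemma embed_inject: "embed p = embed q \<longleftrightarrow> p = q"
proof
  assume "embed p = embed q"
  then have "hat p \<in> span {hat q}" unfolding embed_hat using span_base[of "hat p" "{hat p}"] by auto
  then show "p = q" by (auto simp: span_singleton hat_eq_scale_iff)
qed simp

lemma proj_act_embed: "A *v hat p = k *\<^sub>R hat q \<Longrightarrow> k \<noteq> 0 \<Longrightarrow> proj_act A (embed p) = embed q"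
  unfolding proj_act_def embed_hat by (simp add: linear_span_image[symmetric] span_image_scale[of "{hat q}" "\<lambda>_. k", simplified])

lemma proj_equivalentI:
  assumes "invertible A" "f ` K = K'" "\<And>x. x \<in> K \<Longrightarrow> \<exists>k. k \<noteq> 0 \<and> A *v hat x = k *\<^sub>R hat (f x)"
  shows "proj_equivalent K K'"
  unfolding proj_equivalent_def
proof (intro exI[of _ A] conjI)
  have act: "proj_act A (embed x) = embed (f x)" if "x \<in> K" for x
    using assms(3)[OF that] proj_act_embed by blast
  have "embed x \<notin> singular_line A" if "x \<in> K" for x
  proof
    assume "embed x \<in> singular_line A"
    then have "\<forall>v\<in>embed (f x). v $ 3 = 0" unfolding singular_line_def line_at_infinity_def by (simp add: act that)
    moreover have "hat (f x) \<in> embed (f x)" by (simp add: embed_hat span_base)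
    ultimately show False by force
  qed
  then show "singular_line A \<inter> embed ` K = {}" by blast
  show "proj_act A ` embed ` K = embed ` K'"
    unfolding assms(2)[symmetric] image_image by (rule image_cong) (simp_all add: act)
qed (rule assms(1))

lemma proj_equivalentD:
  assumes "proj_equivalent K K'"
  obtains A f where "invertible A" "f ` K = K'" "\<And>x. x \<in> K \<Longrightarrow> \<exists>k. k \<noteq> 0 \<and> A *v hat x = k *\<^sub>R hat (f x)"
proof -
  obtain A :: "real^3^3" where A: "invertible A" "proj_act A ` embed ` K = embed ` K'"
    using assms unfolding proj_equivalent_def by (elim exE conjE) (rule that)
  have "\<forall>x\<in>K. \<exists>y. y \<in> K' \<and> proj_act A (embed x) = embed y" using A(2) by blast
  from bchoice[OF this] obtain f
    where f: "\<And>x. x \<in> K \<Longrightarrow> f x \<in> K'" "\<And>x. x \<in> K \<Longrightarrow> proj_act A (embed x) = embed (f x)" by auto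
  have "f ` K = K'"
  proof
    show "K' \<subseteq> f ` K"
    proof
      fix y assume "y \<in> K'"
      then have "embed y \<in> proj_act A ` embed ` K" unfolding A(2) by (rule imageI)
      then obtain x where "x \<in> K" "proj_act A (embed x) = embed y" by auto
      then show "y \<in> f ` K" using f(2) embed_inject by auto
    qed
  qed (use f in blast)
  moreover have "\<exists>k. k \<noteq> 0 \<and> A *v hat x = k *\<^sub>R hat (f x)" if "x \<in> K" for x
  proof -
    have "A *v hat x \<in> embed (f x)" using f(2)[OF that] span_base[of "hat x" "{hat x}"]
      unfolding proj_act_def embed_hat by blast
    then obtain k where k: "A *v hat x = k *\<^sub>R hat (f x)" unfolding embed_hat span_singleton by blast
    have "A *v hat x \<noteq> 0" using A(1) hat_neq_0[of x]
      by (metis invertible_def matrix_left_invertible_ker)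
    then show ?thesis using k by auto
  qed
  ultimately show ?thesis using that A(1) by blast
qed

text \<open>The factors \<open>k x\<close> have one sign on \<open>K\<close>, so convex weights stay
  convex after renormalization and the point map is an isomorphism for \<open>between\<close>. The
  inverse matrix acts likewise with factors \<open>1 / k x\<close>.\<close>

lemma proj_equivalent_imp_elem_equiv:
  assumes "convex K" "proj_equivalent K K'"
  shows "elem_equiv K K'"
proof -
  obtain A f where A: "invertible A" "f ` K = K'" "\<And>x. x \<in> K \<Longrightarrow> \<exists>k. k \<noteq> 0 \<and> A *v hat x = k *\<^sub>R hat (f x)"
    using proj_equivalentD[OF assms(2)] by metis
  obtain k where k: "\<And>x. x \<in> K \<Longrightarrow> k x \<noteq> 0" "\<And>x. x \<in> K \<Longrightarrow> A *v hat x = k x *\<^sub>R hat (f x)"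
    using A(3) by metis
  obtain B where B: "B ** A = mat 1" using A(1) by (auto simp: invertible_def)
  have BA: "B *v (A *v v) = v" for v by (simp add: matrix_vector_mul_assoc B)
  have k3: "k x = (A *v hat x) $ 3" if "x \<in> K" for x using k(2)[OF that] by simp
  text \<open>The third coordinate of the image is affine and has no zero on the convex set \<open>K\<close>.\<close>
  have sign: "k a * k b > 0" if "a \<in> K" "b \<in> K" for a b
  proof (rule ccontr)
    assume "\<not> k a * k b > 0"
    then have neg: "k a * k b < 0" using k(1) that by (metis linorder_neqE_linordered_idom mult_eq_0_iff)
    then have ne: "k a \<noteq> k b" by (auto simp: mult_less_0_iff)
    \<comment> \<open>The zero of the affine function \<open>k\<close> on the segment from
      \<open>a\<close> to \<open>b\<close>.\<close>
    define t where "t = k a / (k a - k b)"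
    have t: "0 \<le> t" "t \<le> 1" "(1 - t) * k a + t * k b = 0"
      using neg ne by (auto simp: t_def field_simps mult_less_0_iff)
    define x where "x = (1 - t) *\<^sub>R a + t *\<^sub>R b"
    have "x \<in> K" using assms(1) that t unfolding x_def by (intro convexD) auto
    have "hat x = (1 - t) *\<^sub>R hat a + t *\<^sub>R hat b" by (simp add: x_def vec_eq_iff forall_3)
    then have "k x = (1 - t) * k a + t * k b"
      using that k by (simp add: k3[OF \<open>x \<in> K\<close>] matrix_vector_right_distrib matrix_vector_mult_scaleR)
    then show False using t k(1)[OF \<open>x \<in> K\<close>] by simp
  qed
  have weights: "\<exists>t. 0 \<le> t \<and> t \<le> 1 \<and> hat z = (1 - t) *\<^sub>R u + t *\<^sub>R v"
    if "c *\<^sub>R hat z = \<alpha> *\<^sub>R u + \<beta> *\<^sub>R v" "u $ 3 = 1" "v $ 3 = 1" "\<alpha> * c \<ge> 0" "\<beta> * c \<ge> 0" "c \<noteq> 0" for z u v c \<alpha> \<beta>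
  proof -
    have c: "c = \<alpha> + \<beta>" using arg_cong[OF that(1), of "\<lambda>v. v $ 3"] that(2,3) by simp
    have "0 \<le> \<beta> / c" "0 \<le> \<alpha> / c" using that by (auto simp: zero_le_divide_iff zero_le_mult_iff)
    moreover have "1 - \<beta> / c = \<alpha> / c" using c that(6) by (simp add: field_simps)
    moreover have "hat z = (1 / c) *\<^sub>R (\<alpha> *\<^sub>R u + \<beta> *\<^sub>R v)" using that(1,6) by (simp flip: that(1))
    ultimately show ?thesis by (intro exI[of _ "\<beta> / c"]) (simp add: scaleR_add_right)
  qed
  have btw: "between (f a) (f x) (f b) \<longleftrightarrow> between a x b" if "a \<in> K" "x \<in> K" "b \<in> K" for a x b
  proof
    assume "between a x b"
    then obtain t where t: "0 \<le> t" "t \<le> 1" "hat x = (1 - t) *\<^sub>R hat a + t *\<^sub>R hat b" unfolding between_iff_hat by blast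
    have "k x *\<^sub>R hat (f x) = ((1 - t) * k a) *\<^sub>R hat (f a) + (t * k b) *\<^sub>R hat (f b)"
      unfolding k(2)[OF that(2), symmetric] t(3)
      by (simp add: matrix_vector_right_distrib matrix_vector_mult_scaleR k(2)[OF that(1)] k(2)[OF that(3)])
    then show "between (f a) (f x) (f b)" unfolding between_iff_hat
      using t sign[of a x] sign[of b x] k(1) that by (intro weights) (auto simp: mult.assoc)
  next
    assume "between (f a) (f x) (f b)"
    then obtain t where t: "0 \<le> t" "t \<le> 1" "hat (f x) = (1 - t) *\<^sub>R hat (f a) + t *\<^sub>R hat (f b)" unfolding between_iff_hat by blast
    have inv: "B *v hat (f y) = (1 / k y) *\<^sub>R hat y" if "y \<in> K" for y
      using arg_cong[OF k(2)[OF that], of "\<lambda>v. (1 / k y) *\<^sub>R (B *v v)"] k(1)[OF that]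
      by (simp add: BA matrix_vector_mult_scaleR)
    have "(1 / k x) *\<^sub>R hat x = ((1 - t) * (1 / k a)) *\<^sub>R hat a + (t * (1 / k b)) *\<^sub>R hat b"
      unfolding inv[OF that(2), symmetric] t(3) by (simp add: inv that matrix_vector_right_distrib matrix_vector_mult_scaleR)
    moreover have "(1 / k a) * (1 / k x) > 0" "(1 / k b) * (1 / k x) > 0"
      using sign[of a x] sign[of b x] that by (simp_all add: zero_less_divide_iff zero_less_mult_iff)
    ultimately show "between a x b" unfolding between_iff_hat
      using t k(1) that by (intro weights[of "1 / k x" _ "(1 - t) * (1 / k a)" _ "t * (1 / k b)"]) (auto simp: mult.assoc simp del: times_divide_eq_left times_divide_eq_right)
  qed
  have "inj_on f K"
  proof (rule inj_onI)
    fix x y assume "x \<in> K" "y \<in> K" "f x = f y"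
    then have "between (f x) (f y) (f x)" by (simp add: between_self_iff)
    then show "x = y" using btw[of x y x] \<open>x \<in> K\<close> \<open>y \<in> K\<close> by (simp add: between_self_iff)
  qed
  then have "bij_betw f K K'" using A(2) by (simp add: bij_betw_def)
  then show ?thesis unfolding elem_equiv_def using models_isomorphism[of f K K' between between] btw by blast
qed

section \<open>Convergence of the finite embeddings\<close>

lemma (in asymptotic_embedding) tracking:
  assumes p: "p0 \<in> K" "p1 \<in> K" "p2 \<in> K" and D: "D3 (hat p0) (hat p1) (hat p2) \<noteq> 0"
  obtains T :: "'i \<Rightarrow> real^3^3" where "\<forall>\<^sub>F F in \<F>. det (T F) \<noteq> 0"
    "\<And>x. x \<in> K \<Longrightarrow> \<exists>v. (v \<longlongrightarrow> hat x) \<F> \<and> (\<forall>\<^sub>F F in \<F>. \<exists>s. T F *v v F = s *\<^sub>R hat (g F x))"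
proof -
  define u where "u = (1/3) *\<^sub>R (p0 + p1 + p2)"
  have u: "hat u = (1/3) *\<^sub>R (hat p0 + hat p1 + hat p2)"
    by (simp add: u_def vec_eq_iff forall_3)
  \<comment> \<open>A single predicate on tuples, so that one choice yields the matrix together with
    its weights.\<close>
  define Q where "Q F c \<longleftrightarrow> (case c of (A, a0, a1, a2) \<Rightarrow> det A \<noteq> 0 \<and> a0 > 0 \<and> a1 > 0 \<and> a2 > 0 \<and>
     A *v hat p0 = a0 *\<^sub>R hat (g F p0) \<and> A *v hat p1 = a1 *\<^sub>R hat (g F p1) \<and> A *v hat p2 = a2 *\<^sub>R hat (g F p2) \<and>
     A *v (hat p0 + hat p1 + hat p2) = hat (g F u))" for F and c :: "(real^3^3) \<times> real \<times> real \<times> real"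
  define c where "c F = (SOME c. Q F c)" for F
  have "\<forall>\<^sub>F F in \<F>. Q F (c F)"
    using eventually_frame[OF p D u]
  proof eventually_elim
    case (elim F)
    then have "\<exists>c. Q F c" unfolding Q_def by auto
    then show ?case unfolding c_def by (rule someI_ex)
  qed
  then interpret framed_embedding K K' \<F> g p0 p1 p2 "\<lambda>F. fst (c F)" "\<lambda>F. fst (snd (c F))"
      "\<lambda>F. fst (snd (snd (c F)))" "\<lambda>F. snd (snd (snd (c F)))" u
    by unfold_locales (use p D u in \<open>auto simp: Q_def case_prod_beta elim: eventually_mono\<close>)
  show ?thesis
  proof (rule that[of "\<lambda>F. fst (c F)"])
    show "\<forall>\<^sub>F F in \<F>. det (fst (c F)) \<noteq> 0" using frame by eventually_elim blast
    fix x assume "x \<in> K"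
    then obtain v where "track v (hat x) x" using track_all by blast
    then show "\<exists>v. (v \<longlongrightarrow> hat x) \<F> \<and> (\<forall>\<^sub>F F in \<F>. \<exists>s. fst (c F) *v v F = s *\<^sub>R hat (g F x))"
      unfolding track_def by (intro exI[of _ v]) (auto elim!: eventually_mono)
  qed
qed

text \<open>Up to subfilters and normalization the matrices \<open>T F\<close> converge to some \<open>T\<^sub>0 \<noteq> 0\<close>, and the maps
  \<open>g F\<close> converge to the projective map \<open>T\<^sub>0\<close> wherever the latter is defined.\<close>

lemma limit_of_tracked:
  assumes "closed S" "bounded S" "\<G> \<noteq> bot" and T: "(T \<longlongrightarrow> T0) \<G>" and v: "(v \<longlongrightarrow> hat x) \<G>"
    and gv: "\<forall>\<^sub>F F in \<G>. \<exists>s. T F *v v F = s *\<^sub>R hat (y F)" and S: "\<forall>\<^sub>F F in \<G>. y F \<in> S"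
    and nz: "T0 *v hat x \<noteq> 0"
  obtains z k where "z \<in> S" "k \<noteq> 0" "T0 *v hat x = k *\<^sub>R hat z" "(y \<longlongrightarrow> z) \<G>"
proof -
  define w where "w F = T F *v v F" for F
  have w: "(w \<longlongrightarrow> T0 *v hat x) \<G>"
    unfolding w_def by (rule tendsto_matrix_vector_mult[OF T v])
  define k where "k = (T0 *v hat x) $ 3"
  have wy: "\<forall>\<^sub>F F in \<G>. w F = (w F $ 3) *\<^sub>R hat (y F)"
    using gv by eventually_elim (auto simp: w_def)
  have w3: "((\<lambda>F. w F $ 3) \<longlongrightarrow> k) \<G>" unfolding k_def by (rule tendsto_vec_nth[OF w])
  \<comment> \<open>If the third coordinates tended to 0, then boundedness of \<open>hat\<close> on
    \<open>S\<close> would force \<open>w\<close> to 0, against \<open>nz\<close>.\<close>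
  have "k \<noteq> 0"
  proof
    assume "k = 0"
    have "compact (hat ` S)"
      using assms(1,2) by (intro compact_continuous_image) (auto simp: continuous_on_def compact_eq_bounded_closed intro!: tendsto_intros)
    then have "bounded (hat ` S)" by (rule compact_imp_bounded)
    then obtain C where C: "\<And>z. z \<in> S \<Longrightarrow> norm (hat z) \<le> C"
      unfolding bounded_iff by auto
    have "\<forall>\<^sub>F F in \<G>. norm (w F) \<le> norm (w F $ 3) * C"
      using wy S
    proof eventually_elim
      case (elim F)
      have "norm (w F) = norm (w F $ 3) * norm (hat (y F))" by (subst elim(1)) simp
      then show ?case using C[OF elim(2)] by (simp add: mult_left_mono)
    qed
    then have "(w \<longlongrightarrow> 0) \<G>" using w3 unfolding \<open>k = 0\<close> by (rule tendsto_0_le[rotated])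
    then show False using tendsto_unique[OF \<open>\<G> \<noteq> bot\<close> w] nz by simp
  qed
  define z :: "real^2" where "z = vector [(T0 *v hat x) $ 1 / k, (T0 *v hat x) $ 2 / k]"
  have Tz: "T0 *v hat x = k *\<^sub>R hat z" using \<open>k \<noteq> 0\<close> by (simp add: z_def vec_eq_iff forall_3 k_def)
  have y12: "\<forall>\<^sub>F F in \<G>. w F $ 1 / w F $ 3 = y F $ 1" "\<forall>\<^sub>F F in \<G>. w F $ 2 / w F $ 3 = y F $ 2"
  proof -
    have *: "\<forall>\<^sub>F F in \<G>. w F $ 3 \<noteq> 0" by (rule tendsto_imp_eventually_ne[OF w3 \<open>k \<noteq> 0\<close>])
    have "w F $ 1 / w F $ 3 = y F $ 1 \<and> w F $ 2 / w F $ 3 = y F $ 2" if "w F = (w F $ 3) *\<^sub>R hat (y F)" "w F $ 3 \<noteq> 0" for F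
      using that(2) arg_cong[OF that(1), of "\<lambda>v. v $ 1"] arg_cong[OF that(1), of "\<lambda>v. v $ 2"] by (simp add: field_simps)
    then have "\<forall>\<^sub>F F in \<G>. w F $ 1 / w F $ 3 = y F $ 1 \<and> w F $ 2 / w F $ 3 = y F $ 2"
      using wy * by (auto elim: eventually_elim2)
    then show "\<forall>\<^sub>F F in \<G>. w F $ 1 / w F $ 3 = y F $ 1" "\<forall>\<^sub>F F in \<G>. w F $ 2 / w F $ 3 = y F $ 2"
      by (auto elim: eventually_mono)
  qed
  have "((\<lambda>F. y F $ i) \<longlongrightarrow> z $ i) \<G>" for i
  proof -
    have "((\<lambda>F. w F $ 1 / w F $ 3) \<longlongrightarrow> z $ 1) \<G>" "((\<lambda>F. w F $ 2 / w F $ 3) \<longlongrightarrow> z $ 2) \<G>"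
      unfolding z_def vector_2 by (intro tendsto_divide tendsto_vec_nth[OF w] w3 \<open>k \<noteq> 0\<close>)+
    then have "((\<lambda>F. y F $ 1) \<longlongrightarrow> z $ 1) \<G>" "((\<lambda>F. y F $ 2) \<longlongrightarrow> z $ 2) \<G>"
      using y12 by (blast intro: Lim_transform_eventually)+
    then show ?thesis using exhaust_2[of i] by auto
  qed
  then have yz: "(y \<longlongrightarrow> z) \<G>" by (rule vec_tendstoI)
  then have "z \<in> S" using Lim_in_closed_set[OF assms(1) S assms(3)] by blast
  then show ?thesis using that Tz yz \<open>k \<noteq> 0\<close> by blast
qed

lemma elem_equiv_imp_proj_equivalent:
  assumes K: "convex_body K" "strictly_convex K" "non_conic (frontier K)"
    and K': "convex_body K'" "strictly_convex K'" "positively_curved (frontier K')"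
    and eq: "elem_equiv K K'"
  shows "proj_equivalent K K'"
proof -
  have comp: "compact K" "convex K" "closed K" "compact K'" "closed K'" "bounded K'"
    using K K' by (auto simp: convex_body_def compact_imp_closed compact_imp_bounded)
  have frK: "frontier K \<subseteq> K" using comp(3) by (simp add: frontier_subset_closed)
  define \<F> where "\<F> = finite_subsets_at_top K"
  define P where "P F g \<longleftrightarrow> (\<forall>x. g x \<in> K') \<and>
      (\<forall>a\<in>F. \<forall>x\<in>F. \<forall>b\<in>F. between (g a) (g x) (g b) \<longleftrightarrow> between a x b) \<and>
      (\<forall>x\<in>F. g x \<in> frontier K' \<longleftrightarrow> x \<in> frontier K)" for F g
  define g where "g F = (SOME g. P F g)" for F
  have P: "P F (g F)" if F: "finite F" "F \<subseteq> K" for F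
    unfolding g_def
  proof (rule someI_ex[of "P F"])
    show "\<exists>g. P F g"
      unfolding P_def by (rule elem_equiv_finite_embedding[OF eq K(1,2) K'(1,2) F]) blast
  qed
  have g: "\<And>F x. finite F \<Longrightarrow> F \<subseteq> K \<Longrightarrow> g F x \<in> K'"
    "\<And>F a x b. \<lbrakk>finite F; F \<subseteq> K; a \<in> F; x \<in> F; b \<in> F\<rbrakk> \<Longrightarrow> between (g F a) (g F x) (g F b) \<longleftrightarrow> between a x b"
    "\<And>F x. \<lbrakk>finite F; F \<subseteq> K; x \<in> F\<rbrakk> \<Longrightarrow> g F x \<in> frontier K' \<longleftrightarrow> x \<in> frontier K"
    using P unfolding P_def by simp_all
  have ev: "\<forall>\<^sub>F F in \<F>. finite F \<and> F \<subseteq> K \<and> X \<subseteq> F" if "finite X" "X \<subseteq> K" for X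
    unfolding \<F>_def eventually_finite_subsets_at_top using that by blast
  interpret asymptotic_embedding K K' \<F> g
  proof
    fix a x b assume "a \<in> K" "x \<in> K" "b \<in> K"
    then have "\<forall>\<^sub>F F in \<F>. finite F \<and> F \<subseteq> K \<and> {a, x, b} \<subseteq> F" by (intro ev) auto
    then show "\<forall>\<^sub>F F in \<F>. between (g F a) (g F x) (g F b) = between a x b"
      by eventually_elim (simp add: g(2))
  qed (rule comp(2))
  obtain B where "card B = 3" "B \<subseteq> frontier K"
    using infinite_arbitrarily_large[OF infinite_frontier[OF K(1)]] by blast
  then obtain p0 p1 p2 where p: "p0 \<in> frontier K" "p1 \<in> frontier K" "p2 \<in> frontier K" "p0 \<noteq> p1" "p1 \<noteq> p2" "p0 \<noteq> p2"
    by (auto simp: card_3_iff)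
  obtain T0 where T0: "\<forall>\<^sub>F F in \<F>. det (T0 F) \<noteq> 0"
    "\<And>x. x \<in> K \<Longrightarrow> \<exists>v. (v \<longlongrightarrow> hat x) \<F> \<and> (\<forall>\<^sub>F F in \<F>. \<exists>s. T0 F *v v F = s *\<^sub>R hat (g F x))"
    by (rule tracking[OF _ _ _ frontier_det_neq_0[OF K(1,2) p]]) (use p frK in auto)
  \<comment> \<open>Rescaling leaves the projective map unchanged and confines the matrices to a
    compact set that avoids 0.\<close>
  define T where "T F = (1 / norm (T0 F)) *\<^sub>R T0 F" for F
  have nz: "T0 F \<noteq> 0" if "det (T0 F) \<noteq> 0" for F using that by (auto simp: det_3)
  have nb: "\<F> \<noteq> bot" by (simp add: \<F>_def)
  have sph: "\<forall>\<^sub>F F in \<F>. T F \<in> sphere 0 1"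
    using T0(1) by eventually_elim (use nz in \<open>simp add: T_def\<close>)
  obtain L \<G> where L: "L \<in> sphere 0 1" "\<G> \<le> \<F>" "\<G> \<noteq> bot" "(T \<longlongrightarrow> L) \<G>"
    by (rule compact_subfilter[OF compact_sphere nb sph])
  have L0: "L \<noteq> 0" using L(1) by auto
  have le: "eventually P \<G>" if "eventually P \<F>" for P using that L(2) by (simp add: filter_leD)
  have detT: "\<forall>\<^sub>F F in \<G>. det (T F) \<noteq> 0"
  proof (rule le, use T0(1) in eventually_elim)
    case (elim F)
    then have "invertible (T0 F)" by (simp add: invertible_det_nz)
    then have "invertible (T F)" unfolding T_def using nz[OF elim] by (intro scalar_invertible) auto
    then show ?case by (simp add: invertible_det_nz)
  qed
  have "\<forall>x\<in>K. \<exists>v. (v \<longlongrightarrow> hat x) \<G> \<and> (\<forall>\<^sub>F F in \<G>. \<exists>s. T F *v v F = s *\<^sub>R hat (g F x))"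
  proof
    fix x assume "x \<in> K"
    then obtain v where v: "(v \<longlongrightarrow> hat x) \<F>" "\<forall>\<^sub>F F in \<F>. \<exists>s. T0 F *v v F = s *\<^sub>R hat (g F x)"
      using T0(2) by blast
    have "\<forall>\<^sub>F F in \<F>. \<exists>s. T F *v v F = s *\<^sub>R hat (g F x)"
      using v(2)
    proof eventually_elim
      case (elim F)
      then obtain s where "T0 F *v v F = s *\<^sub>R hat (g F x)" by blast
      then have "T F *v v F = (s / norm (T0 F)) *\<^sub>R hat (g F x)"
        by (simp add: T_def scaleR_matrix_vector_assoc[symmetric])
      then show ?case by blast
    qed
    then show "\<exists>v. (v \<longlongrightarrow> hat x) \<G> \<and> (\<forall>\<^sub>F F in \<G>. \<exists>s. T F *v v F = s *\<^sub>R hat (g F x))"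
      using le tendsto_mono[OF L(2) v(1)] by blast
  qed
  from bchoice[OF this] obtain v where v: "\<And>x. x \<in> K \<Longrightarrow> (v x \<longlongrightarrow> hat x) \<G>"
    "\<And>x. x \<in> K \<Longrightarrow> \<forall>\<^sub>F F in \<G>. \<exists>s. T F *v v x F = s *\<^sub>R hat (g F x)" by blast
  have gK': "\<forall>\<^sub>F F in \<G>. g F x \<in> K'" for x
    using le[OF ev[of "{}"]] by (rule eventually_mono) (auto intro: g(1))
  have gfr: "\<forall>\<^sub>F F in \<G>. g F x \<in> frontier K'" if "x \<in> frontier K" for x
  proof -
    have "\<forall>\<^sub>F F in \<G>. finite F \<and> F \<subseteq> K \<and> {x} \<subseteq> F" using that frK by (intro le ev) auto
    then show ?thesis by (rule eventually_mono) (use g(3) that in auto)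
  qed
  have lim: "\<exists>z\<in>K'. \<exists>k. k \<noteq> 0 \<and> L *v hat x = k *\<^sub>R hat z \<and> ((\<lambda>F. g F x) \<longlongrightarrow> z) \<G> \<and> (x \<in> frontier K \<longrightarrow> z \<in> frontier K')"
    if x: "x \<in> K" "L *v hat x \<noteq> 0" for x
  proof -
    obtain z k where z: "z \<in> K'" "k \<noteq> 0" "L *v hat x = k *\<^sub>R hat z" "((\<lambda>F. g F x) \<longlongrightarrow> z) \<G>"
      by (rule limit_of_tracked[OF comp(5,6) L(3,4) v(1)[OF x(1)] v(2)[OF x(1)] gK' x(2)])
    moreover have "z \<in> frontier K'" if "x \<in> frontier K"
      using Lim_in_closed_set[OF frontier_closed gfr[OF that] L(3) z(4)] .
    ultimately show ?thesis by blast
  qed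
  show ?thesis
  proof (cases "invertible L")
    case True
    have Lnz: "L *v w \<noteq> 0" if "w \<noteq> 0" for w
      using True that by (metis invertible_def matrix_left_invertible_ker)
    have "\<forall>x\<in>K. \<exists>z. z \<in> K' \<and> (\<exists>k. k \<noteq> 0 \<and> L *v hat x = k *\<^sub>R hat z) \<and> (x \<in> frontier K \<longrightarrow> z \<in> frontier K')"
      using lim Lnz hat_neq_0 by blast
    from bchoice[OF this] obtain f where f: "\<And>x. x \<in> K \<Longrightarrow> f x \<in> K'"
      "\<And>x. x \<in> K \<Longrightarrow> \<exists>k. k \<noteq> 0 \<and> L *v hat x = k *\<^sub>R hat (f x)" "\<And>x. x \<in> K \<Longrightarrow> x \<in> frontier K \<Longrightarrow> f x \<in> frontier K'"
      by blast
    have fx: "(L *v hat x) $ 3 \<noteq> 0" "f x = vector [(L *v hat x) $ 1 / (L *v hat x) $ 3, (L *v hat x) $ 2 / (L *v hat x) $ 3]"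
      if "x \<in> K" for x
      using f(2)[OF that] by (auto simp: vec_eq_iff forall_2)
    have cL: "continuous_on K (\<lambda>x. (L *v hat x) $ i)" for i
      unfolding continuous_on_def by (auto intro!: tendsto_vec_nth tendsto_matrix_vector_mult tendsto_intros)
    have "continuous_on K f"
    proof (rule continuous_on_eq)
      have "continuous_on K (\<lambda>x. (vector [(L *v hat x) $ 1 / (L *v hat x) $ 3, (L *v hat x) $ 2 / (L *v hat x) $ 3] :: real^2) $ i)" for i
        using exhaust_2[of i] continuous_on_divide[OF cL cL] fx(1) by auto
      then show "continuous_on K (\<lambda>x. vector [(L *v hat x) $ 1 / (L *v hat x) $ 3, (L *v hat x) $ 2 / (L *v hat x) $ 3] :: real^2)"
        unfolding continuous_on_def by (blast intro: vec_tendstoI)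
    qed (use fx in simp)
    moreover have "inj_on f K"
    proof (rule inj_onI)
      fix x y assume xy: "x \<in> K" "y \<in> K" "f x = f y"
      obtain k k' where k: "k \<noteq> 0" "L *v hat x = k *\<^sub>R hat (f x)" "k' \<noteq> 0" "L *v hat y = k' *\<^sub>R hat (f x)"
        using f(2) xy by metis
      then have "L *v (k' *\<^sub>R hat x - k *\<^sub>R hat y) = 0"
        by (simp add: matrix_vector_mult_diff_distrib matrix_vector_mult_scaleR)
      then have "k' *\<^sub>R hat x - k *\<^sub>R hat y = 0" using Lnz by blast
      then have "hat x = (1 / k') *\<^sub>R (k *\<^sub>R hat y)" by (intro scaleR_eq_imp_eq) (use k in auto)
      then show "x = y" using hat_eq_scale_iff[of x "k / k'" y] by simp
    qed
    moreover have "f ` K \<subseteq> K'" using f(1) by blast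
    moreover have "f ` frontier K \<subseteq> frontier K'" using f(3) frK by blast
    ultimately have "f ` K = K'" by (rule surj_of_frontier[OF K(1) K'(1)])
    then show ?thesis using proj_equivalentI[OF True _ f(2)] by blast
  next
    case False
    then have "det (transpose L) = 0" by (simp add: invertible_det_nz det_transpose)
    then have "\<not> invertible (transpose L)" by (simp add: invertible_det_nz)
    \<comment> \<open>The image of the singular \<open>L\<close> lies in the plane orthogonal to
      \<open>n\<close>. This is a projective line, so it meets the boundary of \<open>K'\<close> in
      a finite set, called \<open>Y\<close> below.\<close>
    then obtain n where n: "n \<noteq> 0" "transpose L *v n = 0"
      using matrix_left_invertible_ker[of "transpose L"] invertible_left_inverse by blast
    have nL: "n \<bullet> (L *v w) = 0" for w
      using n(2) dot_lmul_matrix[of n L w] by simp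
    define E where "E = {x \<in> frontier K. L *v hat x = 0}"
    have E: "finite E" unfolding E_def using infinite_kernel_frontier[OF K(1,2)] L0 by blast
    define Y where "Y = {y \<in> frontier K'. n \<bullet> hat y = 0}"
    have Y: "finite Y" unfolding Y_def by (rule finite_frontier_line[OF K'(1,2) n(1)])
    have limY: "\<exists>z\<in>Y. \<exists>k. k \<noteq> 0 \<and> L *v hat x = k *\<^sub>R hat z \<and> ((\<lambda>F. g F x) \<longlongrightarrow> z) \<G>"
      if "x \<in> frontier K - E" for x
    proof -
      have "x \<in> K" "L *v hat x \<noteq> 0" "x \<in> frontier K" using that frK by (auto simp: E_def)
      with lim obtain z k where z: "z \<in> frontier K'" "k \<noteq> 0" "L *v hat x = k *\<^sub>R hat z" "((\<lambda>F. g F x) \<longlongrightarrow> z) \<G>"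
        by metis
      have "n \<bullet> hat z = 0" using nL[of "hat x"] z(2) by (simp add: z(3))
      then show ?thesis using z unfolding Y_def by blast
    qed
    \<comment> \<open>The boundary points that \<open>L\<close> sends to multiples of
      \<open>hat y\<close>, zero included. Finitely many such sets and \<open>E\<close> cover the
      infinite boundary, so one of them is infinite.\<close>
    define C where "C y = {x \<in> frontier K. cross3 (hat y) (L *v hat x) = 0}" for y
    have "frontier K \<subseteq> E \<union> (\<Union>y\<in>Y. C y)"
    proof
      fix x assume x: "x \<in> frontier K"
      show "x \<in> E \<union> (\<Union>y\<in>Y. C y)"
      proof (cases "x \<in> E")
        case False
        then obtain z k where "z \<in> Y" "L *v hat x = k *\<^sub>R hat z" using limY[of x] x by blast
        then have "x \<in> C z" using x by (simp add: C_def cross_mult_right)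
        then show ?thesis using \<open>z \<in> Y\<close> by blast
      qed simp
    qed
    then have "infinite (\<Union>y\<in>Y. C y)" using infinite_frontier[OF K(1)] E finite_subset by blast
    then obtain y where y: "y \<in> Y" "infinite (C y)" using Y by blast
    \<comment> \<open>\<open>A = 0\<close> says that every value of \<open>L\<close> is a multiple
      of \<open>hat y\<close>, so the single limit \<open>y\<close> serves all boundary points off
      \<open>E\<close>.\<close>
    define A where "A = matrix (\<lambda>w. cross3 (hat y) (L *v w))"
    have "linear (\<lambda>w. cross3 (hat y) (L *v w))"
      by (intro linearI) (simp_all add: matrix_vector_right_distrib cross_add_right matrix_vector_mult_scaleR cross_mult_right)
    then have A: "A *v w = cross3 (hat y) (L *v w)" for w unfolding A_def using matrix_vector_mul(2) by metis
    have "infinite {x \<in> frontier K. A *v hat x = 0}" using y(2) by (simp add: A C_def)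
    then have "A = 0" by (rule infinite_kernel_frontier[OF K(1,2)])
    have limy: "((\<lambda>F. g F x) \<longlongrightarrow> y) \<G>" if x: "x \<in> frontier K - E" for x
    proof -
      obtain z k where z: "k \<noteq> 0" "L *v hat x = k *\<^sub>R hat z" "((\<lambda>F. g F x) \<longlongrightarrow> z) \<G>"
        using limY[OF x] by blast
      have "cross3 (hat y) (k *\<^sub>R hat z) = 0" using A[of "hat x"] \<open>A = 0\<close> by (simp add: z(2))
      then have "cross3 (hat y) (hat z) = 0" using z(1) by (simp add: cross_mult_right)
      then have "y = z" by (simp add: cross3_def vec_eq_iff forall_3 forall_2)
      then show ?thesis using z(3) by simp
    qed
    have yfr: "y \<in> frontier K'" using y(1) by (simp add: Y_def)
    have "pencil1 (\<lambda>i. hat (x i)) = pencil2 (\<lambda>i. hat (x i))"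
      if x: "inj_on x {1..6}" "x ` {1..6} \<subseteq> frontier K - E" for x :: "nat \<Rightarrow> real^2"
    proof -
      have xi: "x i \<in> frontier K - E" "x i \<in> K" if "i \<in> {1..6}" for i
        using x(2) frK imageI[OF that, of x] by blast+
      have injg: "\<forall>\<^sub>F F in \<G>. inj_on (\<lambda>i. g F (x i)) {1..6}"
      proof -
        have "\<forall>\<^sub>F F in \<G>. finite F \<and> F \<subseteq> K \<and> x ` {1..6} \<subseteq> F" using xi by (intro le ev) auto
        then show ?thesis
        proof eventually_elim
          case (elim F)
          have "inj_on (g F) F"
          proof (rule inj_onI)
            fix a b assume "a \<in> F" "b \<in> F" "g F a = g F b"
            then show "a = b" using g(2)[of F a b a] elim by (simp add: between_self_iff)
          qed
          then have "inj_on (g F) (x ` {1..6})" using elim by (auto intro: inj_on_subset)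
          from comp_inj_on[OF x(1) this] show ?case by (simp add: o_def)
        qed
      qed
      let ?Y = "\<lambda>F i. hat (g F (x i))"
      have q: "((\<lambda>F. pencil1 (?Y F) / pencil2 (?Y F)) \<longlongrightarrow> 1) \<G>" "\<forall>\<^sub>F F in \<G>. pencil2 (?Y F) \<noteq> 0"
        using pencil_quotient_tendsto_1[OF K'(3) yfr, of "\<lambda>F i. g F (x i)" \<G>] limy gfr injg xi by auto
      have vx: "((\<lambda>F. v (x i) F) \<longlongrightarrow> hat (x i)) \<G>" if "i \<in> {1..6}" for i
        using v(1) xi(2)[OF that] by blast
      have p: "((\<lambda>F. pencil1 (\<lambda>i. v (x i) F)) \<longlongrightarrow> pencil1 (\<lambda>i. hat (x i))) \<G>"
        "((\<lambda>F. pencil2 (\<lambda>i. v (x i) F)) \<longlongrightarrow> pencil2 (\<lambda>i. hat (x i))) \<G>"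
        by (intro tendsto_pencil vx; assumption)+
      have "\<forall>\<^sub>F F in \<G>. \<forall>i\<in>{1..6}. \<exists>s. T F *v v (x i) F = s *\<^sub>R ?Y F i"
        using v(2) xi(2) by (intro eventually_ball_finite) auto
      \<comment> \<open>Invariance under \<open>T F\<close> carries the quotient from the collapsing
        points \<open>g F (x i)\<close> to the vectors \<open>v (x i) F\<close>, which converge to
        the original points. The product form avoids a division in the limit.\<close>
      then have "\<forall>\<^sub>F F in \<G>. pencil2 (\<lambda>i. v (x i) F) * (pencil1 (?Y F) / pencil2 (?Y F)) = pencil1 (\<lambda>i. v (x i) F)"
        using detT q(2)
      proof eventually_elim
        case (elim F)
        from bchoice[OF elim(1)] obtain s where "\<And>i. i \<in> {1..6} \<Longrightarrow> T F *v v (x i) F = s i *\<^sub>R ?Y F i" by blast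
        from pencil_scale[OF this elim(2)] elim(3) show ?case by (simp add: field_simps)
      qed
      then have "((\<lambda>F. pencil1 (\<lambda>i. v (x i) F)) \<longlongrightarrow> pencil2 (\<lambda>i. hat (x i)) * 1) \<G>"
        by (rule Lim_transform_eventually[OF tendsto_mult[OF p(2) q(1)]])
      then show ?thesis using tendsto_unique[OF L(3) p(1)] by simp
    qed
    then have "\<not> non_conic (frontier K)" by (rule pencil_identity_imp_conic[OF K(1,2) E])
    then show ?thesis using K(3) by simp
  qed
qed

theorem theorem9p39:
  fixes K K' :: "(real^2) set"
  assumes "convex_body K" and "strictly_convex K"
    and "analytic_curve (frontier K)" and "positively_curved (frontier K)"
    and "non_conic (frontier K)"
    and "convex_body K'" and "strictly_convex K'"
    and "analytic_curve (frontier K')" and "positively_curved (frontier K')"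
    and "non_conic (frontier K')"
  shows "elem_equiv K K' \<longleftrightarrow> proj_equivalent K K'"
  using elem_equiv_imp_proj_equivalent[OF assms(1,2,5,6,7,9)] proj_equivalent_imp_elem_equiv[of K K'] assms(1)
  by (auto simp: convex_body_def)

end
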